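(* Let $(E,C)$ be a separated graph and $S$ a subset of $C_{\rm fin}$. Assume that condition $( * )$ holds for $(E,C)$. Then $M(E,C,S)$ is simple if and only if the following conditions hold: (a) $S=C_{\rm fin}$. (b) $E$ is $C$-cofinal.
   Context: A graph is a directed graph $E=(E^0,E^1,s,r)$ with $E^0$ a nonempty set (no finiteness or countability assumptions). A separated graph is a pair $(E,C)$ where $C=\bigsqcup_{v\in E^0}C_v$ and each $C_v$ is a partition of $s^{-1}(v)$ into pairwise disjoint nonempty subsets ($C_v=\emptyset$ if $v$ is a sink). $C_{\rm fin}$ is the set of finite members of $C$, and $C_{v,{\rm fin}}:=C_v\cap C_{\rm fin}$. For finite $Y\subseteq E^1$, $\mathbf r(Y):=\sum_{e\in Y}r(e)$. $M(E,C,S)$ is the abelian monoid with generators $E^0\sqcup\{q'_Z\mid Z\subseteq X\in C,\ 0<|Z|<\infty\}$ and relations: (1) $v=\mathbf r(Z)+q'_Z$ for $v\in E^0$, $Z\subseteq X\in C_v$, $0<|Z|<\infty$; (2) $q'_{Z_1}=\mathbf r(Z_2\setminus Z_1)+q'_{Z_2}$ for finite nonempty subsets $Z_1\subsetneq Z_2$ of $X\in C$; (3) $q'_X=0$ for $X\in S$. An order-ideal of an abelian monoid is a submonoid $I$ such that $x+y\in I$ implies $x,y\in I$. A monoid $M$ is simple if it has precisely two order-ideals, namely $M$ and its group of units (in the conical case, as here: $M\neq0$ and the only order-ideals are $\{0\}$ and $M$). Condition $( * )$ for $(E,C)$ (where, by convention, $(E,C)$ abbreviates the triple $(E,C,C_{\rm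 fin})$). For $v\in E^0$ let $\mathcal Z_v:=C_{v,{\rm fin}}\sqcup\{\text{nonempty finite subsets of members of }C_v\setminus C_{\rm fin}\}$, $\mathcal Z:=\bigsqcup_v\mathcal Z_v$. Let $Q^0:=\{q'_Z\mid Z\in\mathcal Z\setminus C_{\rm fin}\}$ and let $F$ be the free abelian monoid on $E^0\sqcup Q^0$. In $F$ set $\boldsymbol\rho(Z):=\mathbf r(Z)$ if $Z\in C_{\rm fin}$, $\boldsymbol\rho(Z):=\mathbf r(Z)+q'_Z$ if $Z\in\mathcal Z\setminus C_{\rm fin}$, and $\boldsymbol\sigma(Z_1,Z_2):=\mathbf r(Z_2\setminus Z_1)+q'_{Z_2}$ for nonempty $Z_1\subsetneq Z_2$ in $\mathcal Z\setminus C_{\rm fin}$. For $\alpha,\beta\in F$ write $\alpha\rightsquigarrow_1\beta$ if $\alpha=\sum_{i=1}^ku_i+\sum_{i=k+1}^mu_i$ and $\beta=\sum_{i=1}^kr_i+\sum_{i=k+1}^mu_i$ for some $0\le k\le m$ and $u_i\in E^0\sqcup Q^0$ such that for each $i\le k$ either (i) $u_i\in E^0$ is not a sink and $r_i=\boldsymbol\rho(Z_i)$ for some $Z_i\in\mathcal Z_{u_i}$, or (ii) $u_i=q'_{Z_i}\in Q^0$ with $Z_i\in\mathcal Z\setminus C_{\rm fin}$ and $r_i=\boldsymbol\sigma(Z_i,Z_i')$ for some $Z_i'\in\mathcal Z$ with $Z_i\subsetneq Z_i'$. Condition $( * )$: for all $v\in E^0$ and $X,Y\in\mathcal Z_v$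 with $X\cup Y\notin\mathcal Z_v$, there exists $\gamma\in F$ with $\boldsymbol\rho(X)\rightsquigarrow_1\gamma$ and $\boldsymbol\rho(Y)\rightsquigarrow_1\gamma$. $C$-cofinality. Paths of positive length are $e_1e_2\cdots$ with $r(e_i)=s(e_{i+1})$, paths of length $0$ are vertices; infinite paths are forward infinite sequences $(e_1,e_2,\dots)$ with $r(e_i)=s(e_{i+1})$. For a finite or infinite path $\gamma$ of length at least $n$, $\gamma[n]$ is its initial subpath consisting of the first $n$ edges. A vertex $v$ is a $C_{\rm fin}$-sink if $C_{v,{\rm fin}}=\emptyset$. An infinite $C$-multipath in $E$ starting at $v\in E^0$ is a nonempty collection $\Gamma$ of paths in $E$ such that: (A) every path in $\Gamma$ starts at $v$ and either is infinite or ends in a $C_{\rm fin}$-sink; (B) for any integer $n\ge0$ and any $\gamma\in\Gamma$ of length at least $n$, either $r(\gamma[n])$ is a $C_{\rm fin}$-sink or for every $X\in C_{r(\gamma[n]),{\rm fin}}$ there exist $f\in X$ and $\gamma'\in\Gamma$ such that $\gamma'[n+1]=\gamma[n]f$. $\Gamma^0$ is the set of all vertices occurring in the paths in $\Gamma$. $E$ is $C$-cofinal if, given any $w\in E^0$ and any infinite $C$-multipath $\Gamma$ in $E$, there is a (finite) path from $w$ to some vertex in $\Gamma^0$. *)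

theory Defs
  imports
    "HOL-Library.Multiset"
    "HOL-Library.Disjoint_Sets"
    "HOL-Library.Extended_Nat"
    "HOL-Algebra.Group"
    "Graph_Theory.Arc_Walk"
begin

section \<open>Abelian monoids given by generators and relations\<close>

text \<open>The free abelian monoid on \<open>G\<close> consists of the finite multisets over \<open>G\<close>.\<close>

definition free_abmonoid :: "'g set \<Rightarrow> 'g multiset set" where
  "free_abmonoid G = {\<alpha>. set_mset \<alpha> \<subseteq> G}"

inductive_set congruence_gen :: "'g set \<Rightarrow> ('g multiset \<times> 'g multiset) set \<Rightarrow> ('g multiset \<times> 'g multiset) set"
  for G :: "'g set" and R :: "('g multiset \<times> 'g multiset) set" where
  base: "(\<alpha>, \<beta>) \<in> R \<Longrightarrow> (\<alpha>, \<beta>) \<in> congruence_gen G R"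
| refl: "\<alpha> \<in> free_abmonoid G \<Longrightarrow> (\<alpha>, \<alpha>) \<in> congruence_gen G R"
| sym: "(\<alpha>, \<beta>) \<in> congruence_gen G R \<Longrightarrow> (\<beta>, \<alpha>) \<in> congruence_gen G R"
| trans: "\<lbrakk>(\<alpha>, \<beta>) \<in> congruence_gen G R; (\<beta>, \<gamma>) \<in> congruence_gen G R\<rbrakk> \<Longrightarrow> (\<alpha>, \<gamma>) \<in> congruence_gen G R"
| add: "\<lbrakk>(\<alpha>, \<beta>) \<in> congruence_gen G R; (\<alpha>', \<beta>') \<in> congruence_gen G R\<rbrakk> \<Longrightarrow> (\<alpha> + \<alpha>', \<beta> + \<beta>') \<in> congruence_gen G R"

text \<open>HOL-Algebra monoids are written multiplicatively; \<open>mult\<close> below is the addition of the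
  presented abelian monoid and \<open>one\<close> is its zero.\<close>

definition presented_monoid :: "'g set \<Rightarrow> ('g multiset \<times> 'g multiset) set \<Rightarrow> 'g multiset set monoid" where
  "presented_monoid G R =
    \<lparr>carrier = free_abmonoid G // congruence_gen G R,
     mult = (\<lambda>A B. \<Union>\<alpha>\<in>A. \<Union>\<beta>\<in>B. congruence_gen G R `` {\<alpha> + \<beta>}),
     one = congruence_gen G R `` {{#}}\<rparr>"

lemma equiv_congruence_gen:
  assumes "R \<subseteq> free_abmonoid G \<times> free_abmonoid G"
  shows "equiv (free_abmonoid G) (congruence_gen G R)"
proof -
  have "(\<alpha>, \<beta>) \<in> congruence_gen G R \<Longrightarrow> \<alpha> \<in> free_abmonoid G \<and> \<beta> \<in> free_abmonoid G" for \<alpha> \<beta>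
    by (induction rule: congruence_gen.induct) (use assms in \<open>auto simp: free_abmonoid_def\<close>)
  then show ?thesis
    by (auto intro!: equivI refl_onI symI transI intro: congruence_gen.intros)
qed

lemma presented_monoid_mult_class:
  assumes R: "R \<subseteq> free_abmonoid G \<times> free_abmonoid G"
    and "\<alpha> \<in> free_abmonoid G" "\<beta> \<in> free_abmonoid G"
  shows "congruence_gen G R `` {\<alpha>} \<otimes>\<^bsub>presented_monoid G R\<^esub> congruence_gen G R `` {\<beta>}
    = congruence_gen G R `` {\<alpha> + \<beta>}"
proof -
  have "congruent2 (congruence_gen G R) (congruence_gen G R) (\<lambda>\<alpha> \<beta>. congruence_gen G R `` {\<alpha> + \<beta>})"
    by (intro congruent2I' equiv_class_eq[OF equiv_congruence_gen[OF R]] congruence_gen.add)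
  from UN_equiv_class2[OF equiv_congruence_gen[OF R] equiv_congruence_gen[OF R] this assms(2,3)]
  show ?thesis by (simp add: presented_monoid_def)
qed

lemma comm_monoid_presented_monoid:
  assumes R: "R \<subseteq> free_abmonoid G \<times> free_abmonoid G"
  shows "comm_monoid (presented_monoid G R)"
proof -
  let ?M = "presented_monoid G R" and ?c = "\<lambda>\<alpha>. congruence_gen G R `` {\<alpha>}"
  note mult = presented_monoid_mult_class[OF R]
  have carrier: "carrier ?M = ?c ` free_abmonoid G"
    by (auto simp: presented_monoid_def quotient_def)
  have one: "\<one>\<^bsub>?M\<^esub> = ?c {#}" by (simp add: presented_monoid_def)
  have zero: "{#} \<in> free_abmonoid G"
    and add: "\<And>\<alpha> \<beta>. \<alpha> \<in> free_abmonoid G \<Longrightarrow> \<beta> \<in> free_abmonoid G \<Longrightarrow> \<alpha> + \<beta> \<in> free_abmonoid G"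
    by (auto simp: free_abmonoid_def)
  show ?thesis
    by (rule comm_monoidI) (auto simp: carrier one mult zero add ac_simps intro: imageI)
qed

section \<open>Simple abelian monoids\<close>

definition order_ideal :: "'m set \<Rightarrow> ('m, 'b) monoid_scheme \<Rightarrow> bool" where
  "order_ideal I M \<longleftrightarrow> submonoid I M \<and>
    (\<forall>x\<in>carrier M. \<forall>y\<in>carrier M. x \<otimes>\<^bsub>M\<^esub> y \<in> I \<longrightarrow> x \<in> I \<and> y \<in> I)"

definition simple_monoid :: "('m, 'b) monoid_scheme \<Rightarrow> bool" where
  "simple_monoid M \<longleftrightarrow> carrier M \<noteq> Units M \<and> {I. order_ideal I M} = {carrier M, Units M}"

section \<open>Separated graphs\<close>

locale separated_graph = wf_digraph E for E :: "('v, 'e) pre_digraph" (structure) +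
  fixes C :: "'v \<Rightarrow> 'e set set"
  assumes verts_nonempty: "verts E \<noteq> {}"
    and partition: "v \<in> verts E \<Longrightarrow> partition_on (out_arcs E v) (C v)"

text \<open>The family \<open>C\<close> is only meaningful on the vertices of \<open>E\<close>.\<close>

definition C_all :: "('v, 'e) pre_digraph \<Rightarrow> ('v \<Rightarrow> 'e set set) \<Rightarrow> 'e set set" where
  "C_all E C = (\<Union>v\<in>verts E. C v)"

definition C_fin :: "('v, 'e) pre_digraph \<Rightarrow> ('v \<Rightarrow> 'e set set) \<Rightarrow> 'e set set" where
  "C_fin E C = {X \<in> C_all E C. finite X}"

definition C_fin_at :: "('v, 'e) pre_digraph \<Rightarrow> ('v \<Rightarrow> 'e set set) \<Rightarrow> 'v \<Rightarrow> 'e set set" where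
  "C_fin_at E C v = C v \<inter> C_fin E C"

section \<open>The monoid of a separated graph\<close>

text \<open>\<open>Q Z\<close> is the generator $q'_Z$.\<close>

datatype ('v, 'e) gen = Vert 'v | Q "'e set"

definition r_sum :: "('v, 'e) pre_digraph \<Rightarrow> 'e set \<Rightarrow> ('v, 'e) gen multiset" where
  "r_sum E Y = (\<Sum>e\<in>Y. {#Vert (head E e)#})"

definition M_gens :: "('v, 'e) pre_digraph \<Rightarrow> ('v \<Rightarrow> 'e set set) \<Rightarrow> ('v, 'e) gen set" where
  "M_gens E C = Vert ` verts E \<union> {Q Z | Z X. X \<in> C_all E C \<and> Z \<subseteq> X \<and> Z \<noteq> {} \<and> finite Z}"

definition M_rels :: "('v, 'e) pre_digraph \<Rightarrow> ('v \<Rightarrow> 'e set set) \<Rightarrow> 'e set set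
    \<Rightarrow> (('v, 'e) gen multiset \<times> ('v, 'e) gen multiset) set" where
  "M_rels E C S =
    {({#Vert v#}, r_sum E Z + {#Q Z#}) | v Z X.
        v \<in> verts E \<and> X \<in> C v \<and> Z \<subseteq> X \<and> Z \<noteq> {} \<and> finite Z}
    \<union> {({#Q Z1#}, r_sum E (Z2 - Z1) + {#Q Z2#}) | Z1 Z2 X.
        X \<in> C_all E C \<and> Z1 \<subset> Z2 \<and> Z2 \<subseteq> X \<and> Z1 \<noteq> {} \<and> finite Z2}
    \<union> {({#Q X#}, {#}) | X. X \<in> S}"

definition M_monoid :: "('v, 'e) pre_digraph \<Rightarrow> ('v \<Rightarrow> 'e set set) \<Rightarrow> 'e set set
    \<Rightarrow> ('v, 'e) gen multiset set monoid" where
  "M_monoid E C S = presented_monoid (M_gens E C) (M_rels E C S)"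

section \<open>Condition $(*)$\<close>

definition ZZ_at :: "('v, 'e) pre_digraph \<Rightarrow> ('v \<Rightarrow> 'e set set) \<Rightarrow> 'v \<Rightarrow> 'e set set" where
  "ZZ_at E C v = C_fin_at E C v
    \<union> {Z. Z \<noteq> {} \<and> finite Z \<and> (\<exists>X \<in> C v - C_fin E C. Z \<subseteq> X)}"

definition ZZ :: "('v, 'e) pre_digraph \<Rightarrow> ('v \<Rightarrow> 'e set set) \<Rightarrow> 'e set set" where
  "ZZ E C = (\<Union>v\<in>verts E. ZZ_at E C v)"

definition F_gens :: "('v, 'e) pre_digraph \<Rightarrow> ('v \<Rightarrow> 'e set set) \<Rightarrow> ('v, 'e) gen set" where
  "F_gens E C = Vert ` verts E \<union> Q ` (ZZ E C - C_fin E C)"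

definition rho :: "('v, 'e) pre_digraph \<Rightarrow> ('v \<Rightarrow> 'e set set) \<Rightarrow> 'e set \<Rightarrow> ('v, 'e) gen multiset" where
  "rho E C Z = (if Z \<in> C_fin E C then r_sum E Z else r_sum E Z + {#Q Z#})"

definition sigma :: "('v, 'e) pre_digraph \<Rightarrow> 'e set \<Rightarrow> 'e set \<Rightarrow> ('v, 'e) gen multiset" where
  "sigma E Z1 Z2 = r_sum E (Z2 - Z1) + {#Q Z2#}"

definition elem_step :: "('v, 'e) pre_digraph \<Rightarrow> ('v \<Rightarrow> 'e set set)
    \<Rightarrow> ('v, 'e) gen \<Rightarrow> ('v, 'e) gen multiset \<Rightarrow> bool" where
  "elem_step E C u \<beta> \<longleftrightarrow>
    (\<exists>v Z. u = Vert v \<and> v \<in> verts E \<and> out_arcs E v \<noteq> {} \<and> Z \<in> ZZ_at E C v \<and> \<beta> = rho E C Z)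
    \<or> (\<exists>Z Z'. u = Q Z \<and> Z \<in> ZZ E C - C_fin E C \<and> Z' \<in> ZZ E C \<and> Z \<subset> Z' \<and> \<beta> = sigma E Z Z')"

text \<open>In the second alternative above, \<open>Z'\<close> is automatically outside \<open>C_fin\<close>, as it meets an
  infinite member of \<open>C\<close>.\<close>

definition step1 :: "('v, 'e) pre_digraph \<Rightarrow> ('v \<Rightarrow> 'e set set)
    \<Rightarrow> ('v, 'e) gen multiset \<Rightarrow> ('v, 'e) gen multiset \<Rightarrow> bool" where
  "step1 E C \<alpha> \<beta> \<longleftrightarrow> (\<exists>(k::nat) m u r. k \<le> m
    \<and> (\<forall>i\<in>{1..m}. u i \<in> F_gens E C)
    \<and> (\<forall>i\<in>{1..k}. elem_step E C (u i) (r i))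
    \<and> \<alpha> = (\<Sum>i=1..k. {#u i#}) + (\<Sum>i=k+1..m. {#u i#})
    \<and> \<beta> = (\<Sum>i=1..k. r i) + (\<Sum>i=k+1..m. {#u i#}))"

definition condition_star :: "('v, 'e) pre_digraph \<Rightarrow> ('v \<Rightarrow> 'e set set) \<Rightarrow> bool" where
  "condition_star E C \<longleftrightarrow>
    (\<forall>v\<in>verts E. \<forall>X\<in>ZZ_at E C v. \<forall>Y\<in>ZZ_at E C v. X \<union> Y \<notin> ZZ_at E C v \<longrightarrow>
      (\<exists>\<gamma>\<in>free_abmonoid (F_gens E C). step1 E C (rho E C X) \<gamma> \<and> step1 E C (rho E C Y) \<gamma>))"

section \<open>$C$-cofinality\<close>

text \<open>A finite path carries its starting vertex, so that paths of length \<open>0\<close> are vertices.\<close>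

datatype ('v, 'e) gpath = Fin_Path 'v "'e list" | Inf_Path "nat \<Rightarrow> 'e"

fun is_path :: "('v, 'e) pre_digraph \<Rightarrow> ('v, 'e) gpath \<Rightarrow> bool" where
  "is_path E (Fin_Path v es) \<longleftrightarrow> (\<exists>w. pre_digraph.awalk E v es w)"
| "is_path E (Inf_Path f) \<longleftrightarrow> (\<forall>i. f i \<in> arcs E \<and> head E (f i) = tail E (f (Suc i)))"

fun path_source :: "('v, 'e) pre_digraph \<Rightarrow> ('v, 'e) gpath \<Rightarrow> 'v" where
  "path_source E (Fin_Path v es) = v"
| "path_source E (Inf_Path f) = tail E (f 0)"

fun path_length :: "('v, 'e) gpath \<Rightarrow> enat" where
  "path_length (Fin_Path v es) = enat (length es)"
| "path_length (Inf_Path f) = \<infinity>"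

text \<open>The edges of the initial subpath \<open>\<gamma>[n]\<close>, and its final vertex \<open>r(\<gamma>[n])\<close>. All
  paths of a multipath have the same source, so comparing initial subpaths amounts to comparing
  edge lists.\<close>

fun init_edges :: "('v, 'e) gpath \<Rightarrow> nat \<Rightarrow> 'e list" where
  "init_edges (Fin_Path v es) n = take n es"
| "init_edges (Inf_Path f) n = map f [0..<n]"

definition init_range :: "('v, 'e) pre_digraph \<Rightarrow> ('v, 'e) gpath \<Rightarrow> nat \<Rightarrow> 'v" where
  "init_range E \<gamma> n = pre_digraph.awlast E (path_source E \<gamma>) (init_edges \<gamma> n)"

definition C_fin_sink :: "('v, 'e) pre_digraph \<Rightarrow> ('v \<Rightarrow> 'e set set) \<Rightarrow> 'v \<Rightarrow> bool" where
  "C_fin_sink E C v \<longleftrightarrow> v \<in> verts E \<and> C_fin_at E C v = {}"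

definition inf_multipath :: "('v, 'e) pre_digraph \<Rightarrow> ('v \<Rightarrow> 'e set set) \<Rightarrow> 'v \<Rightarrow> ('v, 'e) gpath set \<Rightarrow> bool" where
  "inf_multipath E C v \<Gamma> \<longleftrightarrow> v \<in> verts E \<and> \<Gamma> \<noteq> {} \<and> (\<forall>\<gamma>\<in>\<Gamma>. is_path E \<gamma>)
    \<and> (\<forall>\<gamma>\<in>\<Gamma>. path_source E \<gamma> = v \<and>
         (path_length \<gamma> = \<infinity> \<or> (\<exists>n. path_length \<gamma> = enat n \<and> C_fin_sink E C (init_range E \<gamma> n))))
    \<and> (\<forall>n. \<forall>\<gamma>\<in>\<Gamma>. enat n \<le> path_length \<gamma> \<longrightarrow>
         C_fin_sink E C (init_range E \<gamma> n) \<or>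
         (\<forall>X\<in>C_fin_at E C (init_range E \<gamma> n). \<exists>f\<in>X. \<exists>\<gamma>'\<in>\<Gamma>.
            enat (n + 1) \<le> path_length \<gamma>' \<and> init_edges \<gamma>' (n + 1) = init_edges \<gamma> n @ [f]))"

definition multipath_verts :: "('v, 'e) pre_digraph \<Rightarrow> ('v, 'e) gpath set \<Rightarrow> 'v set" where
  "multipath_verts E \<Gamma> = {init_range E \<gamma> n | \<gamma> n. \<gamma> \<in> \<Gamma> \<and> enat n \<le> path_length \<gamma>}"

definition C_cofinal :: "('v, 'e) pre_digraph \<Rightarrow> ('v \<Rightarrow> 'e set set) \<Rightarrow> bool" where
  "C_cofinal E C \<longleftrightarrow> (\<forall>w\<in>verts E. \<forall>v \<Gamma>. inf_multipath E C v \<Gamma> \<longrightarrow>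
    (\<exists>u\<in>multipath_verts E \<Gamma>. \<exists>p. pre_digraph.awalk E w p u))"

context separated_graph begin

lemma M_rels_in_free:
  assumes "S \<subseteq> C_fin E C"
  shows "M_rels E C S \<subseteq> free_abmonoid (M_gens E C) \<times> free_abmonoid (M_gens E C)"
proof -
  have r: "r_sum E Y \<in> free_abmonoid (M_gens E C)" if "Y \<subseteq> X" "X \<in> C_all E C" for X Y
  proof -
    have "X \<subseteq> arcs E"
      using that(2) partition by (force simp: C_all_def partition_on_def)
    then have "\<And>e. e \<in> Y \<Longrightarrow> e \<in> arcs E" using that(1) by blast
    then show ?thesis
      by (cases "finite Y") (auto simp: r_sum_def free_abmonoid_def M_gens_def set_mset_sum)
  qed
  have "X \<noteq> {}" if "X \<in> C_all E C" for X
    using that partition by (auto simp: C_all_def partition_on_def)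
  then have S: "Q X \<in> M_gens E C" if "X \<in> S" for X
    using that assms by (force simp: M_gens_def C_fin_def)
  have Q: "Q Z \<in> M_gens E C" if "Z \<subseteq> X" "X \<in> C_all E C" "Z \<noteq> {}" "finite Z" for X Z
    using that by (auto simp: M_gens_def)
  have all: "X \<in> C_all E C" if "X \<in> C v" "v \<in> verts E" for X v
    using that by (auto simp: C_all_def)
  have V: "Vert v \<in> M_gens E C" if "v \<in> verts E" for v using that by (simp add: M_gens_def)
  show ?thesis
  proof (rule subsetI)
    fix p assume "p \<in> M_rels E C S"
    then consider
      (1) v Z X where "p = ({#Vert v#}, r_sum E Z + {#Q Z#})" "v \<in> verts E" "X \<in> C v" "Z \<subseteq> X"
          "Z \<noteq> {}" "finite Z"
    | (2) Z1 Z2 X where "p = ({#Q Z1#}, r_sum E (Z2 - Z1) + {#Q Z2#})" "X \<in> C_all E C" "Z1 \<subset> Z2"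
          "Z2 \<subseteq> X" "Z1 \<noteq> {}" "finite Z2"
    | (3) X where "p = ({#Q X#}, {#})" "X \<in> S"
      unfolding M_rels_def by blast
    then show "p \<in> free_abmonoid (M_gens E C) \<times> free_abmonoid (M_gens E C)"
    proof cases
      case 1
      have "r_sum E Z \<in> free_abmonoid (M_gens E C)" "Q Z \<in> M_gens E C"
        using r[OF 1(4) all] Q[OF 1(4) all] 1 by auto
      then show ?thesis using 1 V by (simp add: free_abmonoid_def)
    next
      case 2
      have "Z1 \<subseteq> X" "finite Z1" "Z2 \<noteq> {}" "Z2 - Z1 \<subseteq> X"
        using 2 by (auto intro: finite_subset)
      then show ?thesis using 2 Q[of Z1 X] Q[of Z2 X] r[of "Z2 - Z1" X] by (auto simp: free_abmonoid_def)
    next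
      case 3
      then show ?thesis using S by (simp add: free_abmonoid_def)
    qed
  qed
qed

lemma comm_monoid_M_monoid: "S \<subseteq> C_fin E C \<Longrightarrow> comm_monoid (M_monoid E C S)"
  unfolding M_monoid_def by (intro comm_monoid_presented_monoid M_rels_in_free)

end

end

theory Submission
  imports Defs
begin

text \<open>An order-ideal contains a sum exactly when it contains every summand. In a monoid given by
  generators and relations it is therefore the same thing as a set \<open>H\<close> of generators such that, in
  each relation, one side is supported in \<open>H\<close> if and only if the other one is; such a set is called
  saturated below. Simplicity of \<open>M(E,C,S)\<close> thus becomes a statement about sets of generators: the
  smallest saturated set is \<open>Q ` S\<close>, whose members are equal to zero, and simplicity says that the only
  other one is the set of all generators (\<open>simple_M_monoid_iff_saturated\<close>).

  The set \<open>Q ` C_fin\<close> is saturated and contains no vertex, so simplicity forces \<open>S = C_fin\<close>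
  (\<open>simple_imp_eq_C_fin\<close>).

  Suppose that \<open>S = C_fin\<close> and that \<open>E\<close> is \<open>C\<close>-cofinal. A saturated set larger than \<open>Q ` C_fin\<close>
  contains some vertex \<open>w\<close>, and then every vertex reachable from \<open>w\<close>. If it omitted a vertex \<open>v\<close>, then
  every finite class of edges leaving an omitted vertex would contain an edge leading to an omitted
  vertex, so the paths from \<open>v\<close> through omitted vertices that are infinite or end in a \<open>C_fin\<close>-sink
  would form an infinite multipath that \<open>w\<close> cannot reach (\<open>cofinal_imp_simple\<close>).

  Conversely, let \<open>\<Gamma>\<close> be an infinite multipath that \<open>w\<close> cannot reach. Starting from what is
  reachable from \<open>w\<close>, add every generator that has an elementary step into the set, and repeat. The
  vertices of \<open>\<Gamma>\<close> are never added: a step that adds such a vertex uses a finite class of edges,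
  since an infinite class would involve a generator \<open>Q Z\<close>, and those present belong to vertices
  reachable from \<open>w\<close>; but every finite class at a vertex of \<open>\<Gamma>\<close> has an edge back into \<open>\<Gamma>\<close>
  (\<open>absorbed_disjoint_multipath_verts\<close>). What remains is that the resulting set is saturated. It is
  closed under undoing elementary steps by construction, and condition \<open>(*)\<close> makes it closed under
  performing them: two steps from one generator can be continued to a common multiset, which lies in
  the set if the outcome of one of them does, and then the outcome of the other can be absorbed
  (\<open>absorbed_elem_step\<close>). So there is a saturated set that contains \<open>w\<close> but not the vertices of \<open>\<Gamma>\<close>,
  and the monoid is not simple (\<open>simple_imp_cofinal\<close>).\<close>

section \<open>Order-ideals of a presented abelian monoid\<close>

definition saturated :: "('g multiset \<times> 'g multiset) set \<Rightarrow> 'g set \<Rightarrow> bool" where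
  "saturated R H \<longleftrightarrow> (\<forall>(\<alpha>, \<beta>)\<in>R. set_mset \<alpha> \<subseteq> H \<longleftrightarrow> set_mset \<beta> \<subseteq> H)"

locale abmonoid_presentation =
  fixes G :: "'g set" and R :: "('g multiset \<times> 'g multiset) set"
  assumes relations: "R \<subseteq> free_abmonoid G \<times> free_abmonoid G"
begin

abbreviation M :: "'g multiset set monoid" where "M \<equiv> presented_monoid G R"

abbreviation cls :: "'g multiset \<Rightarrow> 'g multiset set" where
  "cls \<alpha> \<equiv> congruence_gen G R `` {\<alpha>}"

definition ideal_of :: "'g set \<Rightarrow> 'g multiset set set" where
  "ideal_of H = cls ` {\<alpha> \<in> free_abmonoid G. set_mset \<alpha> \<subseteq> H}"

lemma carrier_M: "carrier M = cls ` free_abmonoid G"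
  by (auto simp: presented_monoid_def quotient_def)

lemma one_M: "\<one>\<^bsub>M\<^esub> = cls {#}"
  by (simp add: presented_monoid_def)

lemmas mult_cls = presented_monoid_mult_class[OF relations]

lemma cls_eq_iff:
  assumes "\<alpha> \<in> free_abmonoid G" "\<beta> \<in> free_abmonoid G"
  shows "cls \<alpha> = cls \<beta> \<longleftrightarrow> (\<alpha>, \<beta>) \<in> congruence_gen G R"
  using eq_equiv_class_iff[OF equiv_congruence_gen[OF relations] assms] by simp

lemma zero_free: "{#} \<in> free_abmonoid G"
  by (simp add: free_abmonoid_def)

lemma add_free_iff: "\<alpha> + \<beta> \<in> free_abmonoid G \<longleftrightarrow> \<alpha> \<in> free_abmonoid G \<and> \<beta> \<in> free_abmonoid G"
  by (simp add: free_abmonoid_def)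

lemma single_free_iff: "{#g#} \<in> free_abmonoid G \<longleftrightarrow> g \<in> G"
  by (simp add: free_abmonoid_def)

lemma comm_monoid_M: "comm_monoid M"
  by (rule comm_monoid_presented_monoid[OF relations])

text \<open>The set of multisets supported in \<open>H\<close> is a submonoid of the free monoid which contains
  every summand of its members, so the relations respect it as soon as the generating ones do.\<close>

lemma saturated_congruence:
  assumes "saturated R H" "(\<alpha>, \<beta>) \<in> congruence_gen G R"
  shows "set_mset \<alpha> \<subseteq> H \<longleftrightarrow> set_mset \<beta> \<subseteq> H"
  using assms(2)
proof induction
  case (base \<alpha> \<beta>)
  with assms(1) show ?case by (auto simp only: saturated_def)
qed simp_all

lemma cls_in_ideal_of_iff:
  assumes "saturated R H" "\<alpha> \<in> free_abmonoid G"
  shows "cls \<alpha> \<in> ideal_of H \<longleftrightarrow> set_mset \<alpha> \<subseteq> H"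
proof
  assume "cls \<alpha> \<in> ideal_of H"
  then obtain \<beta> where \<beta>: "\<beta> \<in> free_abmonoid G" "set_mset \<beta> \<subseteq> H" "cls \<alpha> = cls \<beta>"
    by (auto simp: ideal_of_def)
  with saturated_congruence[OF assms(1)] assms(2) show "set_mset \<alpha> \<subseteq> H"
    by (auto simp: cls_eq_iff)
qed (use assms(2) in \<open>auto simp: ideal_of_def\<close>)

lemma order_ideal_ideal_of:
  assumes sat: "saturated R H"
  shows "order_ideal (ideal_of H) M"
  unfolding order_ideal_def
proof (intro conjI ballI impI)
  note [simp] = cls_in_ideal_of_iff[OF sat] mult_cls add_free_iff
  show "submonoid (ideal_of H) M"
  proof
    show "ideal_of H \<subseteq> carrier M"
      by (auto simp: ideal_of_def carrier_M)
    show "\<one>\<^bsub>M\<^esub> \<in> ideal_of H"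
      by (simp add: one_M zero_free)
    fix x y assume "x \<in> ideal_of H" "y \<in> ideal_of H"
    then obtain \<alpha> \<beta> where "x = cls \<alpha>" "y = cls \<beta>" "\<alpha> \<in> free_abmonoid G" "\<beta> \<in> free_abmonoid G"
      "set_mset \<alpha> \<subseteq> H" "set_mset \<beta> \<subseteq> H"
      by (auto simp: ideal_of_def)
    then show "x \<otimes>\<^bsub>M\<^esub> y \<in> ideal_of H"
      by simp
  qed
  fix x y assume "x \<in> carrier M" "y \<in> carrier M" and xy: "x \<otimes>\<^bsub>M\<^esub> y \<in> ideal_of H"
  then obtain \<alpha> \<beta> where "x = cls \<alpha>" "y = cls \<beta>" "\<alpha> \<in> free_abmonoid G" "\<beta> \<in> free_abmonoid G"
    by (auto simp: carrier_M)
  with xy show "x \<in> ideal_of H" "y \<in> ideal_of H"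
    by simp_all
qed

text \<open>An order-ideal contains a sum exactly when it contains every summand, so it is determined
  by the generators whose classes it contains.\<close>

lemma order_ideal_cases:
  assumes I: "order_ideal I M"
  obtains H where "H \<subseteq> G" "saturated R H" "I = ideal_of H"
proof
  define H where "H = {g \<in> G. cls {#g#} \<in> I}"
  interpret submonoid I M
    using I by (simp add: order_ideal_def)
  have split: "cls \<alpha> \<otimes>\<^bsub>M\<^esub> cls \<beta> \<in> I \<longleftrightarrow> cls \<alpha> \<in> I \<and> cls \<beta> \<in> I"
    if "\<alpha> \<in> free_abmonoid G" "\<beta> \<in> free_abmonoid G" for \<alpha> \<beta>
  proof -
    have "cls \<alpha> \<in> carrier M" "cls \<beta> \<in> carrier M"
      using that by (auto simp: carrier_M)
    then show ?thesis
      using I m_closed unfolding order_ideal_def by blast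
  qed
  have mem: "cls \<alpha> \<in> I \<longleftrightarrow> set_mset \<alpha> \<subseteq> H" if "\<alpha> \<in> free_abmonoid G" for \<alpha>
    using that
  proof (induction \<alpha>)
    case empty
    show ?case using one_closed by (simp add: one_M)
  next
    case (add g \<alpha>)
    then have "g \<in> G" "\<alpha> \<in> free_abmonoid G"
      by (auto simp: free_abmonoid_def)
    moreover from this have "cls (add_mset g \<alpha>) = cls {#g#} \<otimes>\<^bsub>M\<^esub> cls \<alpha>"
      by (simp add: mult_cls single_free_iff)
    ultimately show ?case
      using add.IH by (auto simp: split single_free_iff H_def)
  qed
  show "H \<subseteq> G" by (auto simp: H_def)
  show "saturated R H"
    unfolding saturated_def
  proof clarify
    fix \<alpha> \<beta> assume r: "(\<alpha>, \<beta>) \<in> R"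
    then have free: "\<alpha> \<in> free_abmonoid G" "\<beta> \<in> free_abmonoid G"
      using relations by auto
    with r have "cls \<alpha> = cls \<beta>"
      by (simp add: cls_eq_iff congruence_gen.base)
    then show "set_mset \<alpha> \<subseteq> H \<longleftrightarrow> set_mset \<beta> \<subseteq> H"
      using mem[OF free(1)] mem[OF free(2)] by simp
  qed
  have "I \<subseteq> cls ` free_abmonoid G"
    using subset by (simp add: carrier_M)
  then show "I = ideal_of H"
    using mem by (auto simp: ideal_of_def)
qed

lemma ideal_of_inject:
  assumes "saturated R H" "saturated R K" "H \<subseteq> G" "K \<subseteq> G"
  shows "ideal_of H = ideal_of K \<longleftrightarrow> H = K"
proof
  assume eq: "ideal_of H = ideal_of K"
  have "g \<in> H \<longleftrightarrow> g \<in> K" if "g \<in> G" for g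
    using that eq cls_in_ideal_of_iff[OF assms(1), of "{#g#}"]
      cls_in_ideal_of_iff[OF assms(2), of "{#g#}"] by (simp add: single_free_iff)
  with assms(3,4) show "H = K" by blast
qed simp

lemma ideal_of_generators: "ideal_of G = carrier M"
  by (auto simp: ideal_of_def carrier_M free_abmonoid_def)

lemma saturated_generators: "saturated R G"
  using relations by (auto simp: saturated_def free_abmonoid_def)

text \<open>An order-ideal contains the zero element, hence both summands of any decomposition of it; and
  sums of generators equated to zero are themselves zero.\<close>

lemma units_eq_ideal_of_zero_generators:
  assumes sat: "saturated R H" and "H \<subseteq> G"
    and zero: "\<And>g. g \<in> H \<Longrightarrow> ({#g#}, {#}) \<in> R"
  shows "Units M = ideal_of H"
proof
  interpret comm_monoid M by (rule comm_monoid_M)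
  show "Units M \<subseteq> ideal_of H"
  proof
    fix x assume "x \<in> Units M"
    then obtain y where y: "x \<in> carrier M" "y \<in> carrier M" "x \<otimes>\<^bsub>M\<^esub> y = \<one>\<^bsub>M\<^esub>"
      by (auto simp: Units_def)
    have "\<one>\<^bsub>M\<^esub> \<in> ideal_of H"
      by (simp add: one_M cls_in_ideal_of_iff[OF sat] zero_free)
    with y order_ideal_ideal_of[OF sat] show "x \<in> ideal_of H"
      unfolding order_ideal_def by metis
  qed
  show "ideal_of H \<subseteq> Units M"
  proof
    fix x assume "x \<in> ideal_of H"
    then obtain \<alpha> where \<alpha>: "x = cls \<alpha>" "\<alpha> \<in> free_abmonoid G" "set_mset \<alpha> \<subseteq> H"
      by (auto simp: ideal_of_def)
    have "(\<alpha>, {#}) \<in> congruence_gen G R"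
      using \<alpha>(3)
    proof (induction \<alpha>)
      case (add g \<alpha>)
      then have "({#g#}, {#}) \<in> congruence_gen G R" "(\<alpha>, {#}) \<in> congruence_gen G R"
        by (simp_all add: congruence_gen.base zero)
      from congruence_gen.add[OF this] show ?case by simp
    qed (simp add: congruence_gen.refl zero_free)
    then have "x = \<one>\<^bsub>M\<^esub>"
      using \<alpha> by (simp add: one_M cls_eq_iff zero_free)
    then show "x \<in> Units M" by simp
  qed
qed

text \<open>Generators equated to zero lie in every saturated set. If they form a saturated set, then the
  monoid is conical, and simplicity says that this set and the set of all generators are the only
  saturated ones.\<close>

proposition simple_monoid_iff_saturated:
  assumes sat: "saturated R H" and H: "H \<subseteq> G"
    and zero: "\<And>g. g \<in> H \<Longrightarrow> ({#g#}, {#}) \<in> R"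
  shows "simple_monoid M \<longleftrightarrow> H \<noteq> G \<and> (\<forall>K\<subseteq>G. saturated R K \<longrightarrow> K = H \<or> K = G)"
proof -
  note inj = ideal_of_inject
  have ideals: "{I. order_ideal I M} = ideal_of ` {K. K \<subseteq> G \<and> saturated R K}"
    by (auto intro: order_ideal_ideal_of elim: order_ideal_cases)
  have "inj_on ideal_of {K. K \<subseteq> G \<and> saturated R K}"
    by (rule inj_onI) (simp add: inj)
  then have "{I. order_ideal I M} = ideal_of ` {G, H} \<longleftrightarrow> {K. K \<subseteq> G \<and> saturated R K} = {G, H}"
    unfolding ideals using H sat saturated_generators by (intro inj_on_image_eq_iff) auto
  also have "\<dots> \<longleftrightarrow> (\<forall>K\<subseteq>G. saturated R K \<longrightarrow> K = H \<or> K = G)"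
    using H sat saturated_generators by auto
  finally have only: "{I. order_ideal I M} = {ideal_of G, ideal_of H} \<longleftrightarrow>
      (\<forall>K\<subseteq>G. saturated R K \<longrightarrow> K = H \<or> K = G)"
    by simp
  have distinct: "ideal_of G = ideal_of H \<longleftrightarrow> G = H"
    by (rule inj[OF saturated_generators sat order_refl H])
  have units: "Units M = ideal_of H"
    by (rule units_eq_ideal_of_zero_generators[OF assms])
  show ?thesis
    unfolding simple_monoid_def by (simp only: units ideal_of_generators[symmetric] only distinct) blast
qed

end

section \<open>Members of the partitions\<close>

context separated_graph
begin

lemma C_memberD:
  assumes "v \<in> verts E" "X \<in> C v"
  shows "X \<in> C_all E C" "X \<noteq> {}"
    "e \<in> X \<Longrightarrow> e \<in> arcs E \<and> tail E e = v \<and> head E e \<in> verts E"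
proof -
  have "\<Union> (C v) = out_arcs E v" "{} \<notin> C v"
    using partition[OF assms(1)] by (auto simp: partition_on_def)
  then have "e \<in> out_arcs E v" if "e \<in> X"
    using that assms(2) by blast
  with \<open>{} \<notin> C v\<close> show "X \<noteq> {}" "e \<in> X \<Longrightarrow> e \<in> arcs E \<and> tail E e = v \<and> head E e \<in> verts E"
    using assms(2) by (blast, simp)
  show "X \<in> C_all E C"
    using assms unfolding C_all_def by blast
qed

lemma C_all_cases:
  assumes "X \<in> C_all E C"
  obtains v where "v \<in> verts E" "X \<in> C v"
  using assms unfolding C_all_def by blast

lemma C_all_eqI:
  assumes "X \<in> C_all E C" "Y \<in> C_all E C" "e \<in> X" "e \<in> Y"
  shows "X = Y"
proof -
  obtain v w where v: "v \<in> verts E" "X \<in> C v" and w: "w \<in> verts E" "Y \<in> C w"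
    using assms(1,2) by (auto simp: C_all_def)
  then have "v = w"
    using C_memberD(3)[OF v assms(3)] C_memberD(3)[OF w assms(4)] by simp
  then have "disjoint (C v)" "X \<in> C v" "Y \<in> C v"
    using partition v w by (auto simp: partition_on_def)
  with assms(3,4) show ?thesis
    using disjointD[of "C v" X Y] by blast
qed

lemma out_arc_in_C:
  assumes "e \<in> arcs E"
  obtains X where "X \<in> C (tail E e)" "e \<in> X"
proof -
  have "\<Union> (C (tail E e)) = out_arcs E (tail E e)"
    using partition[of "tail E e"] assms by (auto simp: partition_on_def)
  then have "e \<in> \<Union> (C (tail E e))"
    using assms by simp
  then show thesis using that by blast
qed

lemma proper_subset_not_C_all:
  assumes "Z \<subset> X" "Z \<noteq> {}" "X \<in> C_all E C"
  shows "Z \<notin> C_all E C"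
proof
  assume "Z \<in> C_all E C"
  moreover obtain e where "e \<in> Z" "e \<in> X" using assms by blast
  ultimately have "Z = X" using assms(3) C_all_eqI by blast
  with assms(1) show False by simp
qed

lemma set_mset_r_sum: "finite Y \<Longrightarrow> set_mset (r_sum E Y) = Vert ` head E ` Y"
  by (auto simp: r_sum_def set_mset_sum)

text \<open>The three families of relations, read on supports. A sum of ranges over a finite set of edges has
  the heads of these edges as its support.\<close>

lemma saturated_M_rels_iff:
  "saturated (M_rels E C S) H \<longleftrightarrow>
    (\<forall>v\<in>verts E. \<forall>X\<in>C v. \<forall>Z\<subseteq>X. Z \<noteq> {} \<longrightarrow> finite Z \<longrightarrow>
       (Vert v \<in> H \<longleftrightarrow> Vert ` head E ` Z \<subseteq> H \<and> Q Z \<in> H)) \<and>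
    (\<forall>X\<in>C_all E C. \<forall>Z1 Z2. Z1 \<subset> Z2 \<longrightarrow> Z2 \<subseteq> X \<longrightarrow> Z1 \<noteq> {} \<longrightarrow> finite Z2 \<longrightarrow>
       (Q Z1 \<in> H \<longleftrightarrow> Vert ` head E ` (Z2 - Z1) \<subseteq> H \<and> Q Z2 \<in> H)) \<and>
    Q ` S \<subseteq> H" (is "?L \<longleftrightarrow> ?A \<and> ?B \<and> ?C")
proof -
  define R1 :: "(('v, 'e) gen multiset \<times> ('v, 'e) gen multiset) set" where
    "R1 = {({#Vert v#}, r_sum E Z + {#Q Z#}) | v Z X.
        v \<in> verts E \<and> X \<in> C v \<and> Z \<subseteq> X \<and> Z \<noteq> {} \<and> finite Z}"
  define R2 :: "(('v, 'e) gen multiset \<times> ('v, 'e) gen multiset) set" where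
    "R2 = {({#Q Z1#}, r_sum E (Z2 - Z1) + {#Q Z2#}) | Z1 Z2 X.
        X \<in> C_all E C \<and> Z1 \<subset> Z2 \<and> Z2 \<subseteq> X \<and> Z1 \<noteq> {} \<and> finite Z2}"
  define R3 :: "(('v, 'e) gen multiset \<times> ('v, 'e) gen multiset) set" where
    "R3 = {({#Q X#}, {#}) | X. X \<in> S}"
  have "M_rels E C S = R1 \<union> R2 \<union> R3"
    by (simp only: M_rels_def R1_def R2_def R3_def)
  then have "saturated (M_rels E C S) H \<longleftrightarrow> saturated R1 H \<and> saturated R2 H \<and> saturated R3 H"
    by (simp add: saturated_def ball_Un)
  moreover have "saturated R1 H \<longleftrightarrow> (\<forall>v\<in>verts E. \<forall>X\<in>C v. \<forall>Z\<subseteq>X. Z \<noteq> {} \<longrightarrow> finite Z \<longrightarrow>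
      (set_mset {#Vert v#} \<subseteq> H \<longleftrightarrow> set_mset (r_sum E Z + {#Q Z#}) \<subseteq> H))"
    unfolding saturated_def R1_def by blast
  then have "saturated R1 H \<longleftrightarrow> ?A"
    by (simp add: set_mset_r_sum conj_commute)
  moreover have "saturated R2 H \<longleftrightarrow> (\<forall>X\<in>C_all E C. \<forall>Z1 Z2. Z1 \<subset> Z2 \<longrightarrow> Z2 \<subseteq> X \<longrightarrow> Z1 \<noteq> {} \<longrightarrow>
      finite Z2 \<longrightarrow> (set_mset {#Q Z1#} \<subseteq> H \<longleftrightarrow> set_mset (r_sum E (Z2 - Z1) + {#Q Z2#}) \<subseteq> H))"
    unfolding saturated_def R2_def by blast
  then have "saturated R2 H \<longleftrightarrow> ?B"
    by (simp add: set_mset_r_sum conj_commute)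
  moreover have "saturated R3 H \<longleftrightarrow> ?C"
    unfolding saturated_def R3_def by fastforce
  ultimately show ?thesis by (simp only:)
qed

text \<open>In the first two families of relations, one side contains a vertex, as the heads of a nonempty
  set of edges occur in it, and the other side is a vertex or a generator \<open>Q Z\<close> with \<open>Z\<close> properly
  contained in a class. No such generator belongs to \<open>Q ` T\<close>, because distinct classes are disjoint.
  Hence neither side is ever supported in \<open>Q ` T\<close>.\<close>

lemma saturated_Q_image:
  assumes "S \<subseteq> T" "T \<subseteq> C_fin E C"
  shows "saturated (M_rels E C S) (Q ` T)"
proof -
  have proper: "Q Z \<notin> Q ` T" if "Z \<subset> Y" "Y \<subseteq> X" "Z \<noteq> {}" "X \<in> C_all E C" for Z Y X
  proof -
    have "Z \<subset> X" using that by blast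
    from proper_subset_not_C_all[OF this that(3,4)] show ?thesis
      using assms(2) by (auto simp: C_fin_def)
  qed
  have nonempty: "\<not> Vert ` head E ` Z \<subseteq> Q ` T" if "Z \<noteq> {}" for Z
    using that by blast
  have "\<not> Vert ` head E ` (Z2 - Z1) \<subseteq> Q ` T" if "Z1 \<subset> Z2" for Z1 Z2
    by (rule nonempty) (use that in blast)
  with assms(1) show ?thesis
    unfolding saturated_M_rels_iff by (simp add: proper nonempty image_mono) blast
qed

lemma vert_in_M_gens_iff: "Vert v \<in> M_gens E C \<longleftrightarrow> v \<in> verts E"
  by (auto simp: M_gens_def)

lemma simple_M_monoid_iff_saturated:
  assumes S: "S \<subseteq> C_fin E C"
  shows "simple_monoid (M_monoid E C S) \<longleftrightarrow>
    (\<forall>K\<subseteq>M_gens E C. saturated (M_rels E C S) K \<longrightarrow> K = Q ` S \<or> K = M_gens E C)"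
proof -
  interpret abmonoid_presentation "M_gens E C" "M_rels E C S"
    by unfold_locales (rule M_rels_in_free[OF S])
  have "Q ` S \<subseteq> M_gens E C"
  proof
    fix g :: "('v, 'e) gen" assume "g \<in> Q ` S"
    then have "({#g#}, {#}) \<in> M_rels E C S"
      by (auto simp: M_rels_def)
    then show "g \<in> M_gens E C"
      using relations by (auto simp: free_abmonoid_def)
  qed
  moreover have "Q ` S \<noteq> M_gens E C"
    using verts_nonempty vert_in_M_gens_iff by blast
  moreover have "({#g#}, {#}) \<in> M_rels E C S" if "g \<in> Q ` S" for g :: "('v, 'e) gen"
    using that by (auto simp: M_rels_def)
  ultimately show ?thesis
    unfolding M_monoid_def using simple_monoid_iff_saturated[OF saturated_Q_image[OF order_refl S]]
    by simp
qed

lemma simple_imp_eq_C_fin: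
  assumes S: "S \<subseteq> C_fin E C" and "simple_monoid (M_monoid E C S)"
  shows "S = C_fin E C"
proof -
  have "X \<noteq> {}" if "X \<in> C_all E C" for X
    using that C_memberD(2) by (auto elim: C_all_cases)
  then have sub: "Q ` C_fin E C \<subseteq> M_gens E C"
    by (fastforce simp: M_gens_def C_fin_def)
  have "(Q ` C_fin E C :: ('v, 'e) gen set) = Q ` S \<or> Q ` C_fin E C = M_gens E C"
    using simple_M_monoid_iff_saturated[OF S, THEN iffD1, rule_format, OF assms(2) sub]
      saturated_Q_image[OF S order_refl] .
  moreover have "Q ` C_fin E C \<noteq> M_gens E C"
    using verts_nonempty vert_in_M_gens_iff by blast
  ultimately have "(Q ` C_fin E C :: ('v, 'e) gen set) = Q ` S"
    by simp
  then show ?thesis by (simp add: inj_image_eq_iff inj_def)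
qed

section \<open>Multipaths that avoid a set of vertices\<close>

text \<open>The set \<open>A\<close> stands for the vertices whose classes lie in an order-ideal; the walks run through the
  vertices that the order-ideal omits.\<close>

definition avoiding_walk :: "'v set \<Rightarrow> 'v \<Rightarrow> 'e list \<Rightarrow> bool" where
  "avoiding_walk A v p \<longleftrightarrow> awalk v p (awlast v p) \<and> (\<forall>n\<le>length p. awlast v (take n p) \<notin> A)"

text \<open>The largest candidate for a multipath that starts at \<open>v\<close> and does not meet \<open>A\<close>.\<close>

definition avoiding_paths :: "'v set \<Rightarrow> 'v \<Rightarrow> ('v, 'e) gpath set" where
  "avoiding_paths A v = {\<gamma>. is_path E \<gamma> \<and> path_source E \<gamma> = v \<and>
     (path_length \<gamma> = \<infinity> \<or> (\<exists>n. path_length \<gamma> = enat n \<and> C_fin_sink E C (init_range E \<gamma> n))) \<and>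
     (\<forall>n. enat n \<le> path_length \<gamma> \<longrightarrow> avoiding_walk A v (init_edges \<gamma> n))}"

lemma avoiding_walk_append_edge:
  assumes "avoiding_walk A v p" "e \<in> arcs E" "tail E e = awlast v p" "head E e \<notin> A"
  shows "avoiding_walk A v (p @ [e])"
proof -
  have "awlast v (take n (p @ [e])) \<notin> A" if "n \<le> Suc (length p)" for n
    using that assms by (cases "n = Suc (length p)") (simp_all add: avoiding_walk_def awlast_append)
  with assms show ?thesis
    by (simp add: avoiding_walk_def awalk_simps awlast_append)
qed

lemma avoiding_walk_take:
  assumes "avoiding_walk A v p"
  shows "avoiding_walk A v (take n p)"
proof -
  have "awalk v (take n p @ drop n p) (awlast v p)"
    using assms by (simp add: avoiding_walk_def)
  then have "awalk v (take n p) (awlast v (take n p))"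
    unfolding awalk_append_iff by blast
  then show ?thesis
    using assms by (simp add: avoiding_walk_def)
qed

text \<open>If a walk can be prolonged without meeting \<open>A\<close> until it reaches a \<open>C_fin\<close>-sink, then the prolonged
  walk is a member. Otherwise no prolongation ends in a \<open>C_fin\<close>-sink, so one can prolong forever, and
  the limit is an infinite member.\<close>

lemma avoiding_walk_in_avoiding_path:
  assumes q: "avoiding_walk A v q"
    and escape: "\<And>p. avoiding_walk A v p \<Longrightarrow> \<not> C_fin_sink E C (awlast v p) \<Longrightarrow>
      \<exists>e. avoiding_walk A v (p @ [e])"
  shows "\<exists>\<gamma>\<in>avoiding_paths A v. enat (length q) \<le> path_length \<gamma> \<and> init_edges \<gamma> (length q) = q"
proof (cases "\<exists>q'. avoiding_walk A v (q @ q') \<and> C_fin_sink E C (awlast v (q @ q'))")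
  case True
  then obtain q' where q': "avoiding_walk A v (q @ q')" "C_fin_sink E C (awlast v (q @ q'))"
    by blast
  have "is_path E (Fin_Path v (q @ q'))"
    using q'(1) unfolding avoiding_walk_def is_path.simps by blast
  then have "Fin_Path v (q @ q') \<in> avoiding_paths A v"
    using q'(2) avoiding_walk_take[OF q'(1)] by (simp add: avoiding_paths_def init_range_def)
  then show ?thesis by force
next
  case False
  define ext where "ext p = p @ [SOME e. avoiding_walk A v (p @ [e])]" for p
  define P where "P n = (ext ^^ n) q" for n
  have P_Suc: "\<exists>e. P (Suc n) = P n @ [e]" for n
    by (simp add: P_def ext_def)
  have P: "avoiding_walk A v (P n) \<and> (\<exists>q'. P n = q @ q')" for n
  proof (induction n)
    case 0
    show ?case using q by (simp add: P_def)
  next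
    case (Suc n)
    then have "\<not> C_fin_sink E C (awlast v (P n))"
      using False by auto
    with Suc have "\<exists>e. avoiding_walk A v (P n @ [e])"
      using escape by blast
    then have "avoiding_walk A v (P (Suc n))"
      unfolding P_def by (auto simp: ext_def intro: someI)
    then show ?case using Suc P_Suc[of n] by auto
  qed
  have len: "length (P n) = length q + n" for n
    by (induction n) (simp_all add: P_def ext_def)
  have coherent: "P m ! i = P n ! i" if "n \<le> m" "i < length (P n)" for i m n
    using that
  proof (induction m rule: dec_induct)
    case (step m)
    then have "i < length (P m)" by (simp add: len)
    with P_Suc[of m] step show ?case by (auto simp: nth_append)
  qed simp
  \<comment> \<open>The index is \<open>Suc i\<close>, not \<open>i\<close>: if \<open>q\<close> is empty, then \<open>P i\<close> has only \<open>i\<close> edges.\<close>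
  define f where "f i = P (Suc i) ! i" for i
  have init: "init_edges (Inf_Path f) n = take n (P n)" for n
  proof (rule nth_equalityI)
    fix i assume "i < length (init_edges (Inf_Path f) n)"
    then show "init_edges (Inf_Path f) n ! i = take n (P n) ! i"
      using coherent[of "Suc i" n i] by (simp add: f_def len)
  qed (simp add: len)
  have avoids: "avoiding_walk A v (map f [0..<n])" for n
    using avoiding_walk_take[of A v "P n" n] P[of n] init[of n] by simp
  have walk: "awalk v (map f [0..<n]) (awlast v (map f [0..<n]))" for n
    using avoids by (simp add: avoiding_walk_def)
  have edge: "f i \<in> arcs E \<and> tail E (f i) = awlast v (map f [0..<i])" for i
    using walk[of "Suc i"] by (simp add: awalk_simps)
  have "is_path E (Inf_Path f)"
    using edge by (simp add: awlast_append)
  moreover have "path_source E (Inf_Path f) = v"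
    using edge[of 0] by simp
  ultimately have "Inf_Path f \<in> avoiding_paths A v"
    using avoids by (simp add: avoiding_paths_def)
  moreover have "init_edges (Inf_Path f) (length q) = q"
    using P[of "length q"] init[of "length q"] by auto
  ultimately show ?thesis by force
qed

text \<open>Members branch into every finite class \<open>X\<close> along their way because an initial subpath \<open>\<gamma>[n]\<close> followed by a suitable edge \<open>f\<close> of \<open>X\<close>
  again avoids \<open>A\<close>, and every walk that avoids \<open>A\<close> is an initial subpath of a member.\<close>

lemma inf_multipath_avoiding_paths:
  assumes "v \<in> verts E" "v \<notin> A"
    and escape: "\<And>u X. u \<in> verts E \<Longrightarrow> u \<notin> A \<Longrightarrow> X \<in> C_fin_at E C u \<Longrightarrow> \<exists>e\<in>X. head E e \<notin> A"
  shows "inf_multipath E C v (avoiding_paths A v)"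
proof -
  have extend: "\<exists>e\<in>X. avoiding_walk A v (p @ [e])"
    if p: "avoiding_walk A v p" and X: "X \<in> C_fin_at E C (awlast v p)" for p X
  proof -
    have u: "awlast v p \<in> verts E"
      using p awalk_last_in_verts unfolding avoiding_walk_def by blast
    moreover have "awlast v p \<notin> A"
      using p by (auto simp: avoiding_walk_def)
    ultimately obtain e where e: "e \<in> X" "head E e \<notin> A"
      using escape X by blast
    have "e \<in> arcs E" "tail E e = awlast v p"
      using C_memberD(3)[OF u _ e(1)] X by (auto simp: C_fin_at_def)
    with e avoiding_walk_append_edge[OF p] show ?thesis by blast
  qed
  have complete: "\<exists>\<gamma>\<in>avoiding_paths A v. enat (length q) \<le> path_length \<gamma> \<and> init_edges \<gamma> (length q) = q"
    if q: "avoiding_walk A v q" for q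
  proof (rule avoiding_walk_in_avoiding_path[OF q])
    fix p assume p: "avoiding_walk A v p" "\<not> C_fin_sink E C (awlast v p)"
    moreover have "awlast v p \<in> verts E"
      using p(1) awalk_last_in_verts unfolding avoiding_walk_def by blast
    ultimately show "\<exists>e. avoiding_walk A v (p @ [e])"
      using extend unfolding C_fin_sink_def by blast
  qed
  have "avoiding_walk A v []"
    using assms(1,2) by (simp add: avoiding_walk_def awalk_Nil_iff)
  from complete[OF this] have "avoiding_paths A v \<noteq> {}" by blast
  moreover have "\<exists>f\<in>X. \<exists>\<gamma>'\<in>avoiding_paths A v. enat (n + 1) \<le> path_length \<gamma>' \<and>
      init_edges \<gamma>' (n + 1) = init_edges \<gamma> n @ [f]"
    if \<gamma>: "\<gamma> \<in> avoiding_paths A v" "enat n \<le> path_length \<gamma>" and X: "X \<in> C_fin_at E C (init_range E \<gamma> n)"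
    for n \<gamma> X
  proof -
    have "length (init_edges \<gamma> n) = n"
      using \<gamma>(2) by (cases \<gamma>) auto
    moreover have "avoiding_walk A v (init_edges \<gamma> n)" "init_range E \<gamma> n = awlast v (init_edges \<gamma> n)"
      using \<gamma> by (auto simp: avoiding_paths_def init_range_def)
    ultimately show ?thesis
      using extend[of "init_edges \<gamma> n" X] complete X by fastforce
  qed
  ultimately show ?thesis
    using assms(1) unfolding inf_multipath_def by (auto simp: avoiding_paths_def)
qed

lemma multipath_verts_avoiding_paths: "multipath_verts E (avoiding_paths A v) \<inter> A = {}"
proof -
  have "init_range E \<gamma> n \<notin> A" if \<gamma>: "\<gamma> \<in> avoiding_paths A v" "enat n \<le> path_length \<gamma>" for \<gamma> n
  proof -
    have "avoiding_walk A v (init_edges \<gamma> n)" "path_source E \<gamma> = v"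
      using \<gamma> by (auto simp: avoiding_paths_def)
    then show ?thesis by (auto simp: avoiding_walk_def init_range_def)
  qed
  then show ?thesis by (auto simp: multipath_verts_def)
qed

text \<open>Every edge \<open>e\<close> gives a relation between its source and the sum of its head and \<open>Q {e}\<close>, also when the class
  of \<open>e\<close> is infinite, so the property passes along edges.\<close>

lemma saturated_hereditary:
  assumes sat: "saturated (M_rels E C S) H" and "Vert w \<in> H" "awalk w p u"
  shows "Vert u \<in> H"
  using assms(3,2)
proof (induction p arbitrary: w)
  case Nil
  then show ?case by (simp add: awalk_Nil_iff)
next
  case (Cons e p)
  have e: "e \<in> arcs E" "w = tail E e" "awalk (head E e) p u"
    using Cons.prems(1) by (simp_all add: awalk_Cons_iff)
  then obtain X where X: "X \<in> C w" "e \<in> X"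
    using out_arc_in_C by blast
  have "Vert w \<in> H \<longleftrightarrow> Vert ` head E ` {e} \<subseteq> H \<and> Q {e} \<in> H"
    using sat[unfolded saturated_M_rels_iff, THEN conjunct1, rule_format, of w X "{e}"] X e(1,2) by simp
  with Cons.prems have "Vert (head E e) \<in> H"
    by simp
  with Cons.IH e(3) show ?case by blast
qed

theorem cofinal_imp_simple:
  assumes cofinal: "C_cofinal E C"
  shows "simple_monoid (M_monoid E C (C_fin E C))"
  unfolding simple_M_monoid_iff_saturated[OF order_refl]
proof (intro allI impI)
  fix K assume K: "K \<subseteq> M_gens E C" and sat: "saturated (M_rels E C (C_fin E C)) K"
  note rels = sat[unfolded saturated_M_rels_iff]
  have vert_rel: "Vert v \<in> K \<longleftrightarrow> Vert ` head E ` Z \<subseteq> K \<and> Q Z \<in> K"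
    if "v \<in> verts E" "X \<in> C v" "Z \<subseteq> X" "Z \<noteq> {}" "finite Z" for v X Z
    using rels[THEN conjunct1, rule_format, OF that] .
  have fin: "Q X \<in> K" if "X \<in> C_fin E C" for X
    using rels[THEN conjunct2, THEN conjunct2] that by blast
  show "K = Q ` C_fin E C \<or> K = M_gens E C"
  proof (cases "\<exists>w\<in>verts E. Vert w \<in> K")
    case True
    then obtain w where w: "w \<in> verts E" "Vert w \<in> K" by blast
    have verts: "Vert v \<in> K" if v: "v \<in> verts E" for v
    proof (rule ccontr)
      assume "Vert v \<notin> K"
      define A where "A = {u. Vert u \<in> K}"
      have "inf_multipath E C v (avoiding_paths A v)"
      proof (rule inf_multipath_avoiding_paths[OF v])
        show "v \<notin> A" using \<open>Vert v \<notin> K\<close> by (simp add: A_def)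
        fix u X assume u: "u \<in> verts E" "u \<notin> A" and X: "X \<in> C_fin_at E C u"
        then have "X \<in> C u" "X \<in> C_fin E C" "finite X"
          by (auto simp: C_fin_at_def C_fin_def)
        \<comment> \<open>Since \<open>Q X\<close> lies in \<open>K\<close>, the set \<open>K\<close> would contain \<open>u\<close> along with all heads of edges in \<open>X\<close>.\<close>
        with vert_rel[OF u(1), of X X] C_memberD(2)[OF u(1)] fin u(2)
        show "\<exists>e\<in>X. head E e \<notin> A"
          by (auto simp: A_def)
      qed
      then obtain u p where "u \<in> multipath_verts E (avoiding_paths A v)" "awalk w p u"
        using cofinal w(1) unfolding C_cofinal_def by blast
      then show False
        using multipath_verts_avoiding_paths[of A v] saturated_hereditary[OF sat w(2)]
        by (auto simp: A_def)
    qed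
    have "M_gens E C \<subseteq> K"
    proof
      fix g assume "g \<in> M_gens E C"
      then consider v where "g = Vert v" "v \<in> verts E"
        | Z X v where "g = Q Z" "v \<in> verts E" "X \<in> C v" "Z \<subseteq> X" "Z \<noteq> {}" "finite Z"
        by (auto simp: M_gens_def C_all_def)
      then show "g \<in> K"
        by cases (use verts vert_rel in blast)+
    qed
    with K show ?thesis by blast
  next
    case False
    have "g \<in> Q ` C_fin E C" if g: "g \<in> K" for g
    proof -
      have "g \<in> M_gens E C" "g \<notin> Vert ` verts E"
        using g K False by auto
      then obtain Z X where Z: "g = Q Z" "X \<in> C_all E C" "Z \<subseteq> X" "Z \<noteq> {}" "finite Z"
        by (auto simp: M_gens_def)
      show ?thesis
      proof (cases "Z = X")
        case True
        with Z show ?thesis by (auto simp: C_fin_def)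
      next
        case False
        \<comment> \<open>Enlarging \<open>Z\<close> by the edge \<open>e\<close> shows that \<open>Q Z\<close> dominates the vertex \<open>r(e)\<close>.\<close>
        then obtain e where e: "e \<in> X" "e \<notin> Z" using Z(3) by blast
        have "Z \<subset> insert e Z" "insert e Z \<subseteq> X" "finite (insert e Z)" "insert e Z - Z = {e}"
          using e Z by auto
        then have "Vert (head E e) \<in> K"
          using rels[THEN conjunct2, THEN conjunct1, rule_format, OF Z(2), of Z "insert e Z"] g Z(1,4)
          by simp
        moreover have "head E e \<in> verts E"
          using Z(2) e(1) C_memberD(3) by (auto elim!: C_all_cases)
        ultimately show ?thesis
          using \<open>\<not> (\<exists>w\<in>verts E. Vert w \<in> K)\<close> by blast
      qed
    qed
    with fin show ?thesis by blast
  qed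
qed

section \<open>Confluence and the order-ideal generated by a vertex\<close>

lemma ZZ_at_iff:
  assumes v: "v \<in> verts E"
  shows "Z \<in> ZZ_at E C v \<longleftrightarrow> (\<exists>X\<in>C v. Z \<subseteq> X \<and> Z \<noteq> {} \<and> finite Z \<and> (finite X \<longrightarrow> Z = X))"
proof
  have all: "X \<in> C_all E C" "X \<noteq> {}" if "X \<in> C v" for X
    using C_memberD(1,2)[OF v that] .
  show "\<exists>X\<in>C v. Z \<subseteq> X \<and> Z \<noteq> {} \<and> finite Z \<and> (finite X \<longrightarrow> Z = X)" if "Z \<in> ZZ_at E C v"
    using that all unfolding ZZ_at_def C_fin_at_def C_fin_def by blast
  show "Z \<in> ZZ_at E C v" if "\<exists>X\<in>C v. Z \<subseteq> X \<and> Z \<noteq> {} \<and> finite Z \<and> (finite X \<longrightarrow> Z = X)"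
    using that all unfolding ZZ_at_def C_fin_at_def C_fin_def by blast
qed

lemma not_C_fin_of_subset_infinite:
  assumes "Z \<subseteq> X" "Z \<noteq> {}" "X \<in> C_all E C" "infinite X"
  shows "Z \<notin> C_fin E C"
proof (cases "finite Z")
  case True
  with assms have "Z \<subset> X" by blast
  from proper_subset_not_C_all[OF this assms(2,3)] show ?thesis by (simp add: C_fin_def)
qed (simp add: C_fin_def)

lemma ZZ_at_minus_C_fin_iff:
  assumes v: "v \<in> verts E"
  shows "Z \<in> ZZ_at E C v - C_fin E C \<longleftrightarrow>
    (\<exists>X\<in>C v. infinite X \<and> Z \<subseteq> X \<and> Z \<noteq> {} \<and> finite Z)" (is "_ \<longleftrightarrow> ?R")
proof
  assume Z: "Z \<in> ZZ_at E C v - C_fin E C"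
  then obtain X where X: "X \<in> C v" "Z \<subseteq> X" "Z \<noteq> {}" "finite Z" "finite X \<longrightarrow> Z = X"
    unfolding Diff_iff ZZ_at_iff[OF v] by blast
  with Z C_memberD(1)[OF v X(1)] have "infinite X"
    unfolding C_fin_def by blast
  with X show ?R by blast
next
  assume ?R
  then obtain X where X: "X \<in> C v" "infinite X" "Z \<subseteq> X" "Z \<noteq> {}" "finite Z" by blast
  have "Z \<in> ZZ_at E C v"
    unfolding ZZ_at_iff[OF v] using X by blast
  then show "Z \<in> ZZ_at E C v - C_fin E C"
    using not_C_fin_of_subset_infinite[OF X(3,4) C_memberD(1)[OF v X(1)] X(2)] by blast
qed

lemma ZZ_minus_C_fin_iff:
  "Z \<in> ZZ E C - C_fin E C \<longleftrightarrow> (\<exists>X\<in>C_all E C. infinite X \<and> Z \<subseteq> X \<and> Z \<noteq> {} \<and> finite Z)"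
proof -
  have "Z \<in> ZZ E C - C_fin E C \<longleftrightarrow> (\<exists>v\<in>verts E. Z \<in> ZZ_at E C v - C_fin E C)"
    unfolding ZZ_def by blast
  also have "\<dots> \<longleftrightarrow> (\<exists>v\<in>verts E. \<exists>X\<in>C v. infinite X \<and> Z \<subseteq> X \<and> Z \<noteq> {} \<and> finite Z)"
    by (rule bex_cong[OF HOL.refl]) (rule ZZ_at_minus_C_fin_iff)
  finally show ?thesis
    unfolding C_all_def by blast
qed

lemma rho_eq:
  assumes "v \<in> verts E" "X \<in> C v" "Z \<subseteq> X" "Z \<noteq> {}" "finite X \<longrightarrow> Z = X"
  shows "rho E C Z = (if finite X then r_sum E X else r_sum E Z + {#Q Z#})"
  using assms C_memberD(1)[OF assms(1,2)] not_C_fin_of_subset_infinite[OF assms(3,4)]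
  by (auto simp: rho_def C_fin_def)

lemma elem_step_Vert_iff:
  assumes v: "v \<in> verts E"
  shows "elem_step E C (Vert v) \<beta> \<longleftrightarrow>
    (\<exists>X\<in>C v. if finite X then \<beta> = r_sum E X
      else \<exists>Z\<subseteq>X. Z \<noteq> {} \<and> finite Z \<and> \<beta> = r_sum E Z + {#Q Z#})" (is "_ \<longleftrightarrow> ?R")
proof
  assume "elem_step E C (Vert v) \<beta>"
  then obtain Z where "Z \<in> ZZ_at E C v" and \<beta>: "\<beta> = rho E C Z"
    unfolding elem_step_def by blast
  then obtain X where X: "X \<in> C v" "Z \<subseteq> X" "Z \<noteq> {}" "finite Z" "finite X \<longrightarrow> Z = X"
    unfolding ZZ_at_iff[OF v] by blast
  then show ?R
    using rho_eq[OF v X(1,2,3,5)] \<beta> by (intro bexI[of _ X]) (auto split: if_splits)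
next
  assume ?R
  then obtain X where X: "X \<in> C v" "if finite X then \<beta> = r_sum E X
      else \<exists>Z\<subseteq>X. Z \<noteq> {} \<and> finite Z \<and> \<beta> = r_sum E Z + {#Q Z#}" by blast
  have "X \<noteq> {}" using C_memberD(2)[OF v X(1)] .
  have "\<exists>Z\<subseteq>X. Z \<noteq> {} \<and> finite Z \<and> (finite X \<longrightarrow> Z = X) \<and> \<beta> = rho E C Z"
  proof (cases "finite X")
    case True
    then show ?thesis
      using X(2) rho_eq[OF v X(1) order_refl \<open>X \<noteq> {}\<close>] \<open>X \<noteq> {}\<close> by (intro exI[of _ X]) simp
  next
    case False
    then obtain Z where "Z \<subseteq> X" "Z \<noteq> {}" "finite Z" "\<beta> = r_sum E Z + {#Q Z#}"
      using X(2) by auto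
    then show ?thesis
      using False rho_eq[OF v X(1), of Z] by (intro exI[of _ Z]) simp
  qed
  then obtain Z where Z: "Z \<subseteq> X" "Z \<noteq> {}" "finite Z" "finite X \<longrightarrow> Z = X" "\<beta> = rho E C Z"
    by blast
  then obtain e where "e \<in> X" by blast
  then have "e \<in> out_arcs E v"
    using C_memberD(3)[OF v X(1)] by simp
  moreover have "Z \<in> ZZ_at E C v"
    unfolding ZZ_at_iff[OF v] using X(1) Z by blast
  ultimately show "elem_step E C (Vert v) \<beta>"
    unfolding elem_step_def using v Z(5) by blast
qed

lemma elem_step_Q_iff:
  "elem_step E C (Q Z) \<beta> \<longleftrightarrow>
    (\<exists>X\<in>C_all E C. infinite X \<and> Z \<noteq> {} \<and>
      (\<exists>Z'\<subseteq>X. Z \<subset> Z' \<and> finite Z' \<and> \<beta> = r_sum E (Z' - Z) + {#Q Z'#}))" (is "_ \<longleftrightarrow> ?R")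
proof
  assume "elem_step E C (Q Z) \<beta>"
  then obtain Z' where Z: "Z \<in> ZZ E C - C_fin E C" and Z': "Z' \<in> ZZ E C" "Z \<subset> Z'"
      and \<beta>: "\<beta> = sigma E Z Z'"
    unfolding elem_step_def by blast
  have "Z' \<notin> C_fin E C"
  proof
    assume "Z' \<in> C_fin E C"
    moreover obtain X where "X \<in> C_all E C" "infinite X" "Z \<subseteq> X" "Z \<noteq> {}"
      using Z unfolding ZZ_minus_C_fin_iff by blast
    moreover from this obtain e where "e \<in> Z" "e \<in> X" "e \<in> Z'"
      using Z' by blast
    ultimately show False
      using C_all_eqI[of X Z' e] by (simp add: C_fin_def)
  qed
  with Z' obtain X where "X \<in> C_all E C" "infinite X" "Z' \<subseteq> X" "finite Z'"
    using ZZ_minus_C_fin_iff[of Z'] by blast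
  moreover have "Z \<noteq> {}"
    using Z unfolding ZZ_minus_C_fin_iff by blast
  ultimately show ?R
    using Z'(2) \<beta> unfolding sigma_def by blast
next
  assume ?R
  then obtain X Z' where X: "X \<in> C_all E C" "infinite X" "Z \<noteq> {}" "Z' \<subseteq> X" "Z \<subset> Z'" "finite Z'"
      and \<beta>: "\<beta> = r_sum E (Z' - Z) + {#Q Z'#}" by blast
  then have "Z \<subseteq> X" "Z' \<noteq> {}" "finite Z"
    by (auto intro: finite_subset)
  with X have "Z \<in> ZZ E C - C_fin E C" "Z' \<in> ZZ E C - C_fin E C"
    unfolding ZZ_minus_C_fin_iff by blast+
  with X(5) \<beta> show "elem_step E C (Q Z) \<beta>"
    unfolding elem_step_def sigma_def by blast
qed

text \<open>What remains of \<open>step1\<close> when multisets are replaced by their supports: \<open>\<gamma>\<close> is composed of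
  generators of \<open>\<beta>\<close> and of outcomes of elementary steps from generators of \<open>\<beta>\<close>, and each generator
  of \<open>\<beta>\<close> either survives in \<open>\<gamma>\<close> or has a step whose outcome is visible in \<open>\<gamma>\<close>. The first half
  serves sets that are closed under performing steps, the second half sets that are closed under
  undoing them.\<close>

definition expands :: "('v, 'e) gen multiset \<Rightarrow> ('v, 'e) gen multiset \<Rightarrow> bool" where
  "expands \<beta> \<gamma> \<longleftrightarrow>
    (\<forall>x\<in>#\<gamma>. x \<in># \<beta> \<or> (\<exists>y\<in>#\<beta>. \<exists>\<delta>. elem_step E C y \<delta> \<and> x \<in># \<delta>)) \<and>
    (\<forall>y\<in>#\<beta>. y \<in># \<gamma> \<or> (\<exists>\<delta>. elem_step E C y \<delta> \<and> set_mset \<delta> \<subseteq> set_mset \<gamma>))"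

lemma expands_refl: "expands \<beta> \<beta>"
  by (simp add: expands_def)

lemma expands_if_step1:
  assumes "step1 E C \<beta> \<gamma>"
  shows "expands \<beta> \<gamma>"
proof -
  obtain k m :: nat and u r where step: "\<forall>i\<in>{1..k}. elem_step E C (u i) (r i)"
    and \<beta>: "\<beta> = (\<Sum>i=1..k. {#u i#}) + (\<Sum>i=k+1..m. {#u i#})"
    and \<gamma>: "\<gamma> = (\<Sum>i=1..k. r i) + (\<Sum>i=k+1..m. {#u i#})"
    using assms unfolding step1_def by blast
  have set_\<beta>: "set_mset \<beta> = u ` {1..k} \<union> u ` {k+1..m}"
    unfolding \<beta> by (auto simp: set_mset_sum)
  have set_\<gamma>: "set_mset \<gamma> = (\<Union>i\<in>{1..k}. set_mset (r i)) \<union> u ` {k+1..m}"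
    unfolding \<gamma> by (auto simp: set_mset_sum)
  show ?thesis
    unfolding expands_def
  proof (intro conjI ballI)
    fix x assume "x \<in># \<gamma>"
    then consider "x \<in> u ` {k+1..m}" | i where "i \<in> {1..k}" "x \<in># r i"
      unfolding set_\<gamma> by blast
    then show "x \<in># \<beta> \<or> (\<exists>y\<in>#\<beta>. \<exists>\<delta>. elem_step E C y \<delta> \<and> x \<in># \<delta>)"
    proof cases
      case (2 i)
      then have "u i \<in># \<beta>" "elem_step E C (u i) (r i)"
        using step unfolding set_\<beta> by blast+
      with 2 show ?thesis by blast
    qed (simp add: set_\<beta>)
  next
    fix y assume "y \<in># \<beta>"
    then consider "y \<in> u ` {k+1..m}" | i where "i \<in> {1..k}" "y = u i"
      unfolding set_\<beta> by blast
    then show "y \<in># \<gamma> \<or> (\<exists>\<delta>. elem_step E C y \<delta> \<and> set_mset \<delta> \<subseteq> set_mset \<gamma>)"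
    proof cases
      case (2 i)
      then have "set_mset (r i) \<subseteq> set_mset \<gamma>" "elem_step E C (u i) (r i)"
        using step unfolding set_\<gamma> by blast+
      with 2 show ?thesis by blast
    qed (simp add: set_\<gamma>)
  qed
qed

text \<open>The single step \<open>q'\<^sub>Z \<leadsto> \<sigma>(Z, Z')\<close>, applied inside a sum of ranges. It makes any two finite subsets of
  an infinite class comparable through their union.\<close>

lemma expands_enlarge:
  assumes X: "X \<in> C_all E C" "infinite X" and Z: "Z \<noteq> {}" "Z \<subseteq> Z'" "Z' \<subseteq> X" "finite Z'"
    and AB: "finite A" "B = A \<union> (Z' - Z)"
  shows "expands (r_sum E A + {#Q Z#}) (r_sum E B + {#Q Z'#})"
proof (cases "Z = Z'")
  case True
  with AB show ?thesis by (simp add: expands_refl)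
next
  case False
  with Z have "Z \<subset> Z'" by blast
  then have step: "elem_step E C (Q Z) (r_sum E (Z' - Z) + {#Q Z'#})"
    unfolding elem_step_Q_iff using X Z by blast
  have sets: "set_mset (r_sum E A + {#Q Z#}) = Vert ` head E ` A \<union> {Q Z}"
    "set_mset (r_sum E B + {#Q Z'#}) = Vert ` head E ` (A \<union> (Z' - Z)) \<union> {Q Z'}"
    "set_mset (r_sum E (Z' - Z) + {#Q Z'#}) = Vert ` head E ` (Z' - Z) \<union> {Q Z'}"
    using AB Z(4) by (simp_all add: set_mset_r_sum)
  let ?\<beta> = "r_sum E A + {#Q Z#}" and ?\<gamma> = "r_sum E B + {#Q Z'#}"
    and ?\<delta> = "r_sum E (Z' - Z) + {#Q Z'#}"
  have cover: "set_mset ?\<gamma> \<subseteq> set_mset ?\<beta> \<union> set_mset ?\<delta>" "set_mset ?\<beta> \<subseteq> insert (Q Z) (set_mset ?\<gamma>)"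
    and \<delta>: "set_mset ?\<delta> \<subseteq> set_mset ?\<gamma>" and Q: "Q Z \<in># ?\<beta>"
    unfolding sets by blast+
  show ?thesis
    unfolding expands_def
  proof (intro conjI ballI)
    fix x assume "x \<in># ?\<gamma>"
    with cover(1) have "x \<in># ?\<beta> \<or> x \<in># ?\<delta>" by blast
    with step Q show "x \<in># ?\<beta> \<or> (\<exists>y\<in>#?\<beta>. \<exists>\<delta>. elem_step E C y \<delta> \<and> x \<in># \<delta>)" by metis
  next
    fix y assume "y \<in># ?\<beta>"
    with cover(2) have "y \<in># ?\<gamma> \<or> y = Q Z" by blast
    with step \<delta> show "y \<in># ?\<gamma> \<or> (\<exists>\<delta>. elem_step E C y \<delta> \<and> set_mset \<delta> \<subseteq> set_mset ?\<gamma>)" by metis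
  qed
qed

text \<open>Condition \<open>(*)\<close> settles the case of two steps at a vertex for which \<open>Z \<union> W\<close> is not in \<open>ZZ_at\<close>. In
  all other cases the steps coincide or concern finite subsets of one infinite class, and the union
  of these subsets provides the common outcome.\<close>

lemma elem_step_diamond:
  assumes star: "condition_star E C" and \<beta>: "elem_step E C g \<beta>" and \<beta>': "elem_step E C g \<beta>'"
  shows "\<exists>\<gamma>. expands \<beta> \<gamma> \<and> expands \<beta>' \<gamma>"
proof (cases g)
  case (Vert v)
  have v: "v \<in> verts E" using \<beta> unfolding elem_step_def Vert by blast
  obtain Z W where Z: "Z \<in> ZZ_at E C v" "\<beta> = rho E C Z" and W: "W \<in> ZZ_at E C v" "\<beta>' = rho E C W"
    using \<beta> \<beta>' unfolding elem_step_def Vert by blast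
  show ?thesis
  proof (cases "Z \<union> W \<in> ZZ_at E C v")
    case False
    then obtain \<gamma> where "step1 E C \<beta> \<gamma>" "step1 E C \<beta>' \<gamma>"
      using star v Z W unfolding condition_star_def by blast
    then show ?thesis using expands_if_step1 by blast
  next
    case True
    then obtain X where X: "X \<in> C v" "Z \<union> W \<subseteq> X" "finite (Z \<union> W)" "finite X \<longrightarrow> Z \<union> W = X"
      unfolding ZZ_at_iff[OF v] by blast
    \<comment> \<open>\<open>Z\<close> and \<open>W\<close> lie in a common class \<open>X\<close>; if \<open>X\<close> is finite, then both are equal to it.\<close>
    have same: "Y \<noteq> {} \<and> (finite X \<longrightarrow> Y = X)" if Y: "Y \<in> ZZ_at E C v" "Y \<subseteq> X" for Y
    proof -
      obtain X' where X': "X' \<in> C v" "Y \<subseteq> X'" "Y \<noteq> {}" "finite X' \<longrightarrow> Y = X'"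
        using Y(1) unfolding ZZ_at_iff[OF v] by blast
      then obtain e where "e \<in> X" "e \<in> X'" using Y(2) by blast
      then have "X' = X"
        using C_all_eqI C_memberD(1)[OF v] X(1) X'(1) by blast
      with X' show ?thesis by blast
    qed
    have Zs: "Z \<subseteq> X" "Z \<noteq> {}" "finite X \<longrightarrow> Z = X" and Ws: "W \<subseteq> X" "W \<noteq> {}" "finite X \<longrightarrow> W = X"
      using same[OF Z(1)] same[OF W(1)] X(2) by simp_all
    show ?thesis
    proof (cases "finite X")
      case True
      then have "\<beta> = \<beta>'" using Zs(3) Ws(3) Z(2) W(2) by simp
      then show ?thesis using expands_refl by blast
    next
      case False
      have "\<beta> = r_sum E Z + {#Q Z#}" "\<beta>' = r_sum E W + {#Q W#}"
        using rho_eq[OF v X(1) Zs] rho_eq[OF v X(1) Ws] False Z(2) W(2) by simp_all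
      moreover have "expands (r_sum E Y + {#Q Y#}) (r_sum E (Z \<union> W) + {#Q (Z \<union> W)#})"
        if "Y \<noteq> {}" "Y \<subseteq> Z \<union> W" for Y
        using that X(2,3) by (intro expands_enlarge[OF C_memberD(1)[OF v X(1)] False])
          (auto intro: finite_subset)
      ultimately show ?thesis using Zs(2) Ws(2) by blast
    qed
  qed
next
  case (Q Z)
  obtain X Z1 where X: "X \<in> C_all E C" "infinite X" "Z \<noteq> {}"
    and Z1: "Z1 \<subseteq> X" "Z \<subset> Z1" "finite Z1" "\<beta> = r_sum E (Z1 - Z) + {#Q Z1#}"
    using \<beta> unfolding Q elem_step_Q_iff by blast
  obtain X' Z2 where X': "X' \<in> C_all E C"
    and Z2: "Z2 \<subseteq> X'" "Z \<subset> Z2" "finite Z2" "\<beta>' = r_sum E (Z2 - Z) + {#Q Z2#}"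
    using \<beta>' unfolding Q elem_step_Q_iff by blast
  obtain e where "e \<in> X" "e \<in> X'" using X(3) Z1 Z2 by blast
  then have "X' = X" using C_all_eqI[OF X' X(1)] by blast
  with Z1 Z2 have sub: "Z1 \<union> Z2 \<subseteq> X" "finite (Z1 \<union> Z2)" by auto
  have "expands (r_sum E (Y - Z) + {#Q Y#}) (r_sum E (Z1 \<union> Z2 - Z) + {#Q (Z1 \<union> Z2)#})"
    if "Z \<subset> Y" "Y \<subseteq> Z1 \<union> Z2" for Y
  proof (rule expands_enlarge[OF X(1,2) _ that(2) sub])
    show "finite (Y - Z)" using that(2) sub(2) by (auto intro: finite_subset)
  qed (use that in blast)+
  then show ?thesis using Z1 Z2 by blast
qed

text \<open>Under condition \<open>(*)\<close>, these are the generators of \<open>F\<close> in the order-ideal generated by \<open>w\<close>. The rules produce the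
  generators reachable from \<open>w\<close> and then only undo elementary steps.\<close>

inductive_set absorbed :: "'v \<Rightarrow> ('v, 'e) gen set" for w :: 'v where
  vert: "awalk w p u \<Longrightarrow> Vert u \<in> absorbed w"
| quot: "awalk w p u \<Longrightarrow> Z \<in> ZZ_at E C u - C_fin E C \<Longrightarrow> Q Z \<in> absorbed w"
| unstep: "elem_step E C g \<beta> \<Longrightarrow> \<forall>x\<in>#\<beta>. x \<in> absorbed w \<Longrightarrow> g \<in> absorbed w"

text \<open>Vertices and generators reachable from \<open>w\<close> have only steps to reachable ones. A generator added
  by undoing a step to \<open>\<beta>0\<close> is handled by induction: if \<open>\<beta>\<close> is the outcome of another step, let \<open>\<gamma>\<close>
  be a common expansion of \<open>\<beta>0\<close> and \<open>\<beta>\<close>; the induction hypothesis for the members of \<open>\<beta>0\<close> puts \<open>\<gamma>\<close>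
  into the set, and undoing the steps from \<open>\<beta>\<close> to \<open>\<gamma>\<close> puts \<open>\<beta>\<close> into it.\<close>

lemma absorbed_elem_step:
  assumes star: "condition_star E C" and "g \<in> absorbed w" and "elem_step E C g \<beta>"
  shows "set_mset \<beta> \<subseteq> absorbed w"
proof -
  have reach: "Vert (head E e) \<in> absorbed w" if "awalk w p u" "X \<in> C u" "e \<in> X" for p u X e
  proof -
    have "e \<in> arcs E" "tail E e = u"
      using C_memberD(3)[OF awalk_last_in_verts[OF that(1)] that(2,3)] by auto
    then have "awalk w (p @ [e]) (head E e)"
      using awalk_appendI[OF that(1)] arc_implies_awalk by blast
    then show ?thesis by (rule absorbed.vert)
  qed
  have quot_closed: "set_mset (r_sum E (Z' - Z) + {#Q Z'#}) \<subseteq> absorbed w"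
    if "awalk w p u" "X \<in> C u" "infinite X" "Z' \<subseteq> X" "Z' \<noteq> {}" "finite Z'" for p u X Z Z'
  proof -
    have "Z' \<in> ZZ_at E C u - C_fin E C"
      unfolding ZZ_at_minus_C_fin_iff[OF awalk_last_in_verts[OF that(1)]] using that by blast
    then have "Q Z' \<in> absorbed w" using that(1) by (rule absorbed.quot[rotated])
    moreover have "Vert ` head E ` (Z' - Z) \<subseteq> absorbed w"
      using reach[OF that(1,2)] that(4) by blast
    ultimately show ?thesis using that(6) by (simp add: set_mset_r_sum)
  qed
  show ?thesis
    using assms(2,3)
  proof (induction arbitrary: \<beta>)
    case (vert p u)
    have u: "u \<in> verts E" using vert(1) by (rule awalk_last_in_verts)
    obtain X where X: "X \<in> C u" "if finite X then \<beta> = r_sum E X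
        else \<exists>Z\<subseteq>X. Z \<noteq> {} \<and> finite Z \<and> \<beta> = r_sum E Z + {#Q Z#}"
      using vert(2) unfolding elem_step_Vert_iff[OF u] by blast
    show ?case
    proof (cases "finite X")
      case True
      then have "set_mset \<beta> = Vert ` head E ` X" using X(2) by (simp add: set_mset_r_sum)
      then show ?thesis using reach[OF vert(1) X(1)] by auto
    next
      case False
      then obtain Z where "Z \<subseteq> X" "Z \<noteq> {}" "finite Z" "\<beta> = r_sum E Z + {#Q Z#}"
        using X(2) by auto
      \<comment> \<open>\<open>rho\<close> of \<open>Z\<close> is \<open>sigma\<close> of the pair \<open>{}\<close>, \<open>Z\<close>.\<close>
      then show ?thesis using quot_closed[OF vert(1) X(1) False, of Z "{}"] by simp
    qed
  next
    case (quot p u Z)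
    have u: "u \<in> verts E" using quot(1) by (rule awalk_last_in_verts)
    obtain X where X: "X \<in> C u" "infinite X" "Z \<subseteq> X" "Z \<noteq> {}"
      using quot(2) unfolding ZZ_at_minus_C_fin_iff[OF u] by blast
    obtain X' Z' where X': "X' \<in> C_all E C" "Z' \<subseteq> X'" "Z \<subset> Z'" "finite Z'"
        "\<beta> = r_sum E (Z' - Z) + {#Q Z'#}"
      using quot(3) unfolding elem_step_Q_iff by blast
    obtain e where "e \<in> X" "e \<in> X'" using X X' by blast
    then have "X' = X" using C_all_eqI[OF X'(1) C_memberD(1)[OF u X(1)]] by blast
    with X' X(4) show ?case
      using quot_closed[OF quot(1) X(1,2), of Z' Z]
      by blast
  next
    case (unstep g \<beta>0)
    obtain \<gamma> where \<gamma>: "expands \<beta>0 \<gamma>" "expands \<beta> \<gamma>"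
      using elem_step_diamond[OF star unstep.hyps(1) unstep.prems] by blast
    have sub: "set_mset \<gamma> \<subseteq> absorbed w"
      using \<gamma>(1) unstep.IH unfolding expands_def by blast
    show ?case
    proof
      fix x assume x: "x \<in># \<beta>"
      show "x \<in> absorbed w"
      proof (cases "x \<in># \<gamma>")
        case False
        then obtain \<delta> where \<delta>: "elem_step E C x \<delta>" "set_mset \<delta> \<subseteq> set_mset \<gamma>"
          using x \<gamma>(2) unfolding expands_def by blast
        have "\<forall>y\<in>#\<delta>. y \<in> absorbed w" using \<delta>(2) sub by blast
        with \<delta>(1) show ?thesis by (rule absorbed.unstep)
      qed (use sub in blast)
    qed
  qed
qed

text \<open>Undoing a step never creates a generator \<open>Q Z\<close> at a new vertex, since every step from \<open>Q Z\<close> leaves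
  a generator \<open>Q Z'\<close> with \<open>Z'\<close> in the same class.\<close>

lemma absorbed_Q_imp_awalk:
  assumes "Q Z \<in> absorbed w"
  shows "\<exists>p u. awalk w p u \<and> Z \<in> ZZ_at E C u - C_fin E C"
proof -
  have "\<forall>Z. g = Q Z \<longrightarrow> (\<exists>p u. awalk w p u \<and> Z \<in> ZZ_at E C u - C_fin E C)" if "g \<in> absorbed w" for g
    using that
  proof induction
    case (unstep g \<beta>)
    show ?case
    proof (intro allI impI)
      fix Z assume g: "g = Q Z"
      obtain X Z' where X: "X \<in> C_all E C" "infinite X" "Z \<noteq> {}" "Z' \<subseteq> X" "Z \<subset> Z'" "finite Z'"
        and \<beta>: "\<beta> = r_sum E (Z' - Z) + {#Q Z'#}"
        using unstep.hyps(1) unfolding g elem_step_Q_iff by blast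
      have "Q Z' \<in># \<beta>" by (simp add: \<beta>)
      then obtain p u where p: "awalk w p u" and Z': "Z' \<in> ZZ_at E C u - C_fin E C"
        using unstep.IH by blast
      have u: "u \<in> verts E" using p by (rule awalk_last_in_verts)
      obtain Y where "Y \<in> C u" "infinite Y" "Z' \<subseteq> Y"
        using Z' unfolding ZZ_at_minus_C_fin_iff[OF u] by blast
      moreover have "finite Z" using X(5,6) by (auto intro: finite_subset)
      ultimately have "Z \<in> ZZ_at E C u - C_fin E C"
        unfolding ZZ_at_minus_C_fin_iff[OF u] using X(3,5) by blast
      with p show "\<exists>p u. awalk w p u \<and> Z \<in> ZZ_at E C u - C_fin E C" by blast
    qed
  qed blast+
  with assms show ?thesis by blast
qed

lemma multipath_verts_step:
  assumes \<Gamma>: "inf_multipath E C v \<Gamma>" and u: "u \<in> multipath_verts E \<Gamma>" and X: "X \<in> C_fin_at E C u"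
  shows "\<exists>f\<in>X. head E f \<in> multipath_verts E \<Gamma>"
proof -
  obtain \<gamma> n where \<gamma>: "\<gamma> \<in> \<Gamma>" "enat n \<le> path_length \<gamma>" "u = init_range E \<gamma> n"
    using u unfolding multipath_verts_def by blast
  have "\<not> C_fin_sink E C u"
    using X unfolding C_fin_sink_def by blast
  then obtain f \<gamma>' where f: "f \<in> X" "\<gamma>' \<in> \<Gamma>" "enat (n + 1) \<le> path_length \<gamma>'"
    and init: "init_edges \<gamma>' (n + 1) = init_edges \<gamma> n @ [f]"
    using \<Gamma> \<gamma> X unfolding inf_multipath_def by blast
  have "init_range E \<gamma>' (n + 1) = head E f"
    unfolding init_range_def init by (simp add: awlast_append)
  with f show ?thesis unfolding multipath_verts_def by force
qed

text \<open>Suppose that a vertex of \<open>\<Gamma>\<close> were added by undoing a step at a class \<open>X\<close>. If \<open>X\<close> is finite, then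
  some edge of \<open>X\<close> leads back into \<open>\<Gamma>\<close>, to a vertex that was added earlier. If \<open>X\<close> is infinite, then
  some \<open>Q Z\<close> with \<open>Z \<subseteq> X\<close> was present, so the vertex is reachable from \<open>w\<close>.\<close>

lemma absorbed_disjoint_multipath_verts:
  assumes \<Gamma>: "inf_multipath E C v \<Gamma>"
    and unreachable: "\<And>u p. u \<in> multipath_verts E \<Gamma> \<Longrightarrow> \<not> awalk w p u"
    and u: "Vert u \<in> absorbed w"
  shows "u \<notin> multipath_verts E \<Gamma>"
proof -
  have "\<forall>u. g = Vert u \<longrightarrow> u \<notin> multipath_verts E \<Gamma>" if "g \<in> absorbed w" for g
    using that
  proof induction
    case (unstep g \<beta>)
    show ?case
    proof (intro allI impI notI)
      fix u assume g: "g = Vert u" and \<Gamma>u: "u \<in> multipath_verts E \<Gamma>"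
      have u: "u \<in> verts E"
        using unstep.hyps(1) unfolding g elem_step_def by blast
      obtain X where X: "X \<in> C u" "if finite X then \<beta> = r_sum E X
          else \<exists>Z\<subseteq>X. Z \<noteq> {} \<and> finite Z \<and> \<beta> = r_sum E Z + {#Q Z#}"
        using unstep.hyps(1) unfolding g elem_step_Vert_iff[OF u] by blast
      show False
      proof (cases "finite X")
        case True
        then have "X \<in> C_fin_at E C u"
          using X(1) C_memberD(1)[OF u X(1)] by (simp add: C_fin_at_def C_fin_def)
        then obtain f where "f \<in> X" "head E f \<in> multipath_verts E \<Gamma>"
          using multipath_verts_step[OF \<Gamma> \<Gamma>u] by blast
        moreover have "set_mset \<beta> = Vert ` head E ` X"
          using X(2) True by (simp add: set_mset_r_sum)
        ultimately show False
          using unstep.IH by blast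
      next
        case False
        then obtain Z where Z: "Z \<subseteq> X" "Z \<noteq> {}" "\<beta> = r_sum E Z + {#Q Z#}"
          using X(2) by auto
        then have "Q Z \<in> absorbed w"
          using unstep.IH by simp
        then obtain p u' where p: "awalk w p u'" and Z': "Z \<in> ZZ_at E C u' - C_fin E C"
          using absorbed_Q_imp_awalk by blast
        have u': "u' \<in> verts E" using p by (rule awalk_last_in_verts)
        obtain Y where Y: "Y \<in> C u'" "Z \<subseteq> Y"
          using Z' unfolding ZZ_at_minus_C_fin_iff[OF u'] by blast
        obtain e where "e \<in> X" "e \<in> Y" using Z Y by blast
        then have "u' = u"
          using C_memberD(3)[OF u X(1)] C_memberD(3)[OF u' Y(1)] by auto
        with unreachable[OF \<Gamma>u] p show False by blast
      qed
    qed
  qed (use unreachable in blast)+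
  with u show ?thesis by blast
qed

text \<open>The generators of \<open>M(E,C,C_fin)\<close> that are missing from \<open>F\<close> are the \<open>q'\<^sub>Z\<close> with \<open>Z\<close> contained in a
  finite class \<open>X\<close>. As \<open>q'\<^sub>X = 0\<close>, the relations express them through vertices, namely
  \<open>q'\<^sub>Z = \<^bold>r(X \<setminus> Z)\<close>, so a set of generators of \<open>F\<close> extends in only one way.\<close>

definition with_complements :: "('v, 'e) gen set \<Rightarrow> ('v, 'e) gen set" where
  "with_complements H = {Vert v | v. v \<in> verts E \<and> Vert v \<in> H} \<union>
    {Q Z | Z X. X \<in> C_all E C \<and> Z \<subseteq> X \<and> Z \<noteq> {} \<and> finite Z \<and>
      (if finite X then Vert ` head E ` (X - Z) \<subseteq> H else Q Z \<in> H)}"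

lemma vert_in_with_complements_iff: "Vert v \<in> with_complements H \<longleftrightarrow> v \<in> verts E \<and> Vert v \<in> H"
  by (auto simp: with_complements_def)

lemma Q_in_with_complements_iff:
  assumes "X \<in> C_all E C" "Z \<subseteq> X" "Z \<noteq> {}" "finite Z"
  shows "Q Z \<in> with_complements H \<longleftrightarrow> (if finite X then Vert ` head E ` (X - Z) \<subseteq> H else Q Z \<in> H)"
proof -
  have "X' = X" if "X' \<in> C_all E C" "Z \<subseteq> X'" for X'
    using that assms C_all_eqI[of X' X] by blast
  moreover have "Q Z \<in> with_complements H \<longleftrightarrow> (\<exists>X'\<in>C_all E C. Z \<subseteq> X' \<and>
      (if finite X' then Vert ` head E ` (X' - Z) \<subseteq> H else Q Z \<in> H))"
    using assms(3,4) by (simp add: with_complements_def image_iff Bex_def)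
  ultimately show ?thesis
    using assms(1,2) by metis
qed

lemma heads_in_with_complements_iff:
  assumes "X \<in> C_all E C" "Z \<subseteq> X"
  shows "Vert ` head E ` Z \<subseteq> with_complements H \<longleftrightarrow> Vert ` head E ` Z \<subseteq> H"
proof -
  obtain v where v: "v \<in> verts E" "X \<in> C v"
    using assms(1) by (rule C_all_cases)
  then have "head E e \<in> verts E" if "e \<in> Z" for e
    using C_memberD(3)[OF v, of e] assms(2) that by blast
  then show ?thesis
    by (auto simp: image_subset_iff vert_in_with_complements_iff)
qed

lemma saturated_with_complements:
  assumes closed: "\<And>g \<beta>. elem_step E C g \<beta> \<Longrightarrow> g \<in> H \<longleftrightarrow> set_mset \<beta> \<subseteq> H"
  shows "saturated (M_rels E C (C_fin E C)) (with_complements H)"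
  unfolding saturated_M_rels_iff
proof (intro conjI ballI allI impI)
  fix v X Z assume v: "v \<in> verts E" "X \<in> C v" and Z: "Z \<subseteq> X" "Z \<noteq> {}" "finite Z"
  note X = C_memberD(1)[OF v]
  show "Vert v \<in> with_complements H \<longleftrightarrow>
    Vert ` head E ` Z \<subseteq> with_complements H \<and> Q Z \<in> with_complements H"
  proof (cases "finite X")
    case True
    then have "elem_step E C (Vert v) (r_sum E X)"
      unfolding elem_step_Vert_iff[OF v(1)] using v(2) by auto
    then have "Vert v \<in> H \<longleftrightarrow> Vert ` head E ` X \<subseteq> H"
      using closed True by (simp add: set_mset_r_sum)
    moreover have "(Vert ` head E ` X :: ('v, 'e) gen set) = Vert ` head E ` Z \<union> Vert ` head E ` (X - Z)"
      using Z by blast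
    ultimately have "Vert v \<in> H \<longleftrightarrow> Vert ` head E ` Z \<subseteq> H \<and> Vert ` head E ` (X - Z) \<subseteq> H"
      by (simp only: Un_subset_iff)
    then show ?thesis
      using v(1) True
      by (simp add: heads_in_with_complements_iff[OF X Z(1)] Q_in_with_complements_iff[OF X Z]
          vert_in_with_complements_iff)
  next
    case False
    then have "elem_step E C (Vert v) (r_sum E Z + {#Q Z#})"
      unfolding elem_step_Vert_iff[OF v(1)] using v(2) Z by auto
    then have "Vert v \<in> H \<longleftrightarrow> Vert ` head E ` Z \<subseteq> H \<and> Q Z \<in> H"
      using closed Z by (simp add: set_mset_r_sum conj_commute)
    then show ?thesis
      using v(1) False by (simp add: heads_in_with_complements_iff[OF X Z(1)]
          Q_in_with_complements_iff[OF X Z] vert_in_with_complements_iff)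
  qed
next
  fix X Z1 Z2
  assume X: "X \<in> C_all E C" and Z: "Z1 \<subset> Z2" "Z2 \<subseteq> X" "Z1 \<noteq> {}" "finite Z2"
  show "Q Z1 \<in> with_complements H \<longleftrightarrow>
    Vert ` head E ` (Z2 - Z1) \<subseteq> with_complements H \<and> Q Z2 \<in> with_complements H"
  proof -
    have Z': "Z1 \<subseteq> X" "finite Z1" "Z2 \<noteq> {}" "Z2 - Z1 \<subseteq> X"
      using Z by (auto intro: finite_subset)
    note iffs = heads_in_with_complements_iff[OF X Z'(4)]
      Q_in_with_complements_iff[OF X Z'(1) Z(3) Z'(2)]
      Q_in_with_complements_iff[OF X Z(2) Z'(3) Z(4)]
    show ?thesis
    proof (cases "finite X")
      case True
      have "X - Z1 = (Z2 - Z1) \<union> (X - Z2)" using Z by blast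
      then show ?thesis
        unfolding iffs using True by (simp add: image_Un)
    next
      case False
      then have "elem_step E C (Q Z1) (r_sum E (Z2 - Z1) + {#Q Z2#})"
        unfolding elem_step_Q_iff using X Z by blast
      then have "Q Z1 \<in> H \<longleftrightarrow> Vert ` head E ` (Z2 - Z1) \<subseteq> H \<and> Q Z2 \<in> H"
        using closed Z(4) by (simp add: set_mset_r_sum conj_commute)
      then show ?thesis
        unfolding iffs using False by simp
    qed
  qed
next
  show "Q ` C_fin E C \<subseteq> with_complements H"
  proof
    fix g assume "g \<in> (Q ` C_fin E C :: ('v, 'e) gen set)"
    then obtain X where X: "g = Q X" "X \<in> C_all E C" "finite X"
      by (auto simp: C_fin_def)
    moreover from X(2) have "X \<noteq> {}"
      by (rule C_all_cases) (rule C_memberD(2))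
    ultimately show "g \<in> with_complements H"
      by (simp add: Q_in_with_complements_iff[of X])
  qed
qed

theorem simple_imp_cofinal:
  assumes star: "condition_star E C" and simple: "simple_monoid (M_monoid E C (C_fin E C))"
  shows "C_cofinal E C"
  unfolding C_cofinal_def
proof (intro ballI allI impI, rule ccontr)
  fix w v \<Gamma>
  assume w: "w \<in> verts E" and \<Gamma>: "inf_multipath E C v \<Gamma>"
    and "\<not> (\<exists>u\<in>multipath_verts E \<Gamma>. \<exists>p. awalk w p u)"
  then have unreachable: "\<And>u p. u \<in> multipath_verts E \<Gamma> \<Longrightarrow> \<not> awalk w p u"
    by blast
  have "saturated (M_rels E C (C_fin E C)) (with_complements (absorbed w))"
  proof (rule saturated_with_complements, rule iffI)
    fix g \<beta> assume step: "elem_step E C g \<beta>"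
    show "set_mset \<beta> \<subseteq> absorbed w" if "g \<in> absorbed w"
      using absorbed_elem_step[OF star that step] .
    show "g \<in> absorbed w" if "set_mset \<beta> \<subseteq> absorbed w"
      by (rule absorbed.unstep[OF step]) (use that in blast)
  qed
  moreover have "with_complements (absorbed w) \<subseteq> M_gens E C"
    unfolding with_complements_def M_gens_def by blast
  moreover have "Vert w \<in> with_complements (absorbed w)"
    using w absorbed.vert[of w "[]" w] by (simp add: vert_in_with_complements_iff awalk_Nil_iff)
  ultimately have all: "with_complements (absorbed w) = M_gens E C"
    using simple_M_monoid_iff_saturated[OF order_refl, THEN iffD1, rule_format, OF simple]
    by blast
  obtain \<gamma> where \<gamma>: "\<gamma> \<in> \<Gamma>" and v: "v \<in> verts E" "path_source E \<gamma> = v"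
    using \<Gamma> unfolding inf_multipath_def by blast
  have "init_range E \<gamma> 0 = v"
    using v(2) by (cases \<gamma>) (simp_all add: init_range_def)
  then have "v \<in> multipath_verts E \<Gamma>"
    using \<gamma> unfolding multipath_verts_def by (force simp flip: zero_enat_def)
  moreover have "Vert v \<in> absorbed w"
    using all v(1) vert_in_M_gens_iff vert_in_with_complements_iff by blast
  ultimately show False
    using absorbed_disjoint_multipath_verts[OF \<Gamma> unreachable] by blast
qed

end

theorem theorem7p6:
  fixes E :: "('v, 'e) pre_digraph" and C :: "'v \<Rightarrow> 'e set set" and S :: "'e set set"
  assumes "separated_graph E C"
    and "S \<subseteq> C_fin E C"
    and "condition_star E C"
  shows "simple_monoid (M_monoid E C S) \<longleftrightarrow> S = C_fin E C \<and> C_cofinal E C"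
proof -
  interpret separated_graph E C by (rule assms(1))
  show ?thesis
    using simple_imp_eq_C_fin[OF assms(2)] simple_imp_cofinal[OF assms(3)] cofinal_imp_simple by blast
qed

end
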